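(* Let $\mathbb{F}$ be a field and $d\ge 3$ an integer. Let $\{\theta_i\}_{i=0}^d$, $\{\theta^*_i\}_{i=0}^d$, $\{\phi_i\}_{i=1}^d$ be scalars in $\mathbb{F}$ such that $\theta_i\neq\theta_j$ and $\theta^*_i\neq\theta^*_j$ if $i\ne j$ $(0\le i,j\le d)$, and $\phi_i\neq 0$ $(1\le i\le d)$. Let $A$ be the $(d+1)\times(d+1)$ lower bidiagonal matrix over $\mathbb{F}$ with $(i,i)$-entry $\theta_{d-i}$ $(0\le i\le d)$, $(i,i-1)$-entry $1$ $(1\le i\le d)$, and all other entries $0$. Let $A^*$ be the $(d+1)\times(d+1)$ upper bidiagonal matrix over $\mathbb{F}$ with $(i,i)$-entry $\theta^*_i$ $(0\le i\le d)$, $(i-1,i)$-entry $\phi_i$ $(1\le i\le d)$, and all other entries $0$. For $0\le i\le d$ let $E_i$ (resp. $E^*_i$) be the primitive idempotent of $A$ (resp. $A^*$) for the eigenvalue $\theta_i$ (resp. $\theta^*_i$). Define $\vartheta_0=0$, $\vartheta_{d+1}=0$ and $$\vartheta_i=\phi_i-(\theta^*_i-\theta^*_0)(\theta_{d-i+1}-\theta_0)\qquad(1\le i\le d).$$ Assume that there exists $\beta\in\mathbb{F}$ such that (i) $\{\theta_i\}_{i=0}^d$ is $\beta$-recurrent; (ii) $\{\theta^*_i\}_{i=0}^d$ is $\beta$-recurrent; (iii) $\{\vartheta_i\}_{i=0}^{d+1}$ is $\beta$-recurrent. Further assume that $\vartheta_1\neq\vartheta_d$. Then the sequence $(A;\{E_i\}_{i=0}^d;A^*;\{E^*_i\}_{i=0}^d)$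 is a circular Hessenberg (CH) system on $\mathbb{F}^{d+1}$.
   Context: Rows and columns of $(d+1)\times(d+1)$ matrices are indexed by $0,1,\dots,d$, and matrices act on column vectors $\mathbb{F}^{d+1}$ by left multiplication. For a scalar $\beta$, a sequence $\{\sigma_i\}_{i=0}^n$ of scalars in $\mathbb{F}$ is $\beta$-recurrent if $\sigma_{i-2}-(\beta+1)\sigma_{i-1}+(\beta+1)\sigma_i-\sigma_{i+1}=0$ for $2\le i\le n-1$. Let $V$ be a vector space over $\mathbb{F}$ of dimension $d+1$. An element of $\mathrm{End}(V)$ is multiplicity-free if it is diagonalizable and each eigenspace has dimension one (equivalently it has $d+1$ distinct eigenvalues in $\mathbb{F}$). The primitive idempotent of a multiplicity-free $B$ for an eigenvalue $\theta$ is the $E\in\mathrm{End}(V)$ that acts as the identity on the $\theta$-eigenspace of $B$ and as $0$ on every other eigenspace. A circular Hessenberg system (CH system) on $V$ is a sequence $(A;\{E_i\}_{i=0}^d;A^*;\{E^*_i\}_{i=0}^d)$ of elements of $\mathrm{End}(V)$ such that: (i) $A$ and $A^*$ are multiplicity-free; (ii) $\{E_i\}_{i=0}^d$ is an ordering of the primitive idempotents of $A$; (iii) $\{E^*_i\}_{i=0}^d$ is an ordering of the primitive idempotents of $A^*$; (iv) for $0\le i,j\le d$, $E_iA^*E_j=0$ if $1<i-j$ or $1<j-i<d$, and $E_iA^*E_j\ne0$ if $i-j=1$ or $j-i=d$; (v) for $0\le i,j\le d$, $E^*_iAE^*_j=0$ if $1<i-j$ or $1<j-i<d$, and $E^*_iAE^*_j\ne0$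 if $i-j=1$ or $j-i=d$. (Here $A^*$ is just a name for a second map; it is not an adjoint of $A$.) *)

theory Defs
  imports "Jordan_Normal_Form.Matrix_Kernel" "Jordan_Normal_Form.Char_Poly"
begin

text \<open>The vector space is \<open>F^n\<close>, and elements of \<open>End(F^n)\<close> are identified with their
  \<open>n \<times> n\<close> matrices, acting on column vectors by \<open>*\<^sub>v\<close>.\<close>

text \<open>Only the terms \<open>\<sigma> 0, \<dots>, \<sigma> n\<close> of the sequence matter.\<close>

definition beta_recurrent :: "'a::field \<Rightarrow> nat \<Rightarrow> (nat \<Rightarrow> 'a) \<Rightarrow> bool" where
  "beta_recurrent \<beta> n \<sigma> \<longleftrightarrow>
     (\<forall>i. 2 \<le> i \<and> i \<le> n - 1 \<longrightarrow>
        \<sigma> (i - 2) - (\<beta> + 1) * \<sigma> (i - 1) + (\<beta> + 1) * \<sigma> i - \<sigma> (i + 1) = 0)"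

definition diagonalizable_mat :: "'a::field mat \<Rightarrow> bool" where
  "diagonalizable_mat B \<longleftrightarrow> (\<exists>D. diagonal_mat D \<and> similar_mat B D)"

text \<open>Since \<open>char_matrix B \<theta>\<close> is \<open>B - \<theta> I\<close>, the dimension of the eigenspace below
  is \<open>kernel_dim (char_matrix B \<theta>)\<close>.\<close>

definition eigenspace :: "'a::field mat \<Rightarrow> 'a \<Rightarrow> 'a vec set" where
  "eigenspace B \<theta> = mat_kernel (char_matrix B \<theta>)"

definition multiplicity_free :: "nat \<Rightarrow> 'a::field mat \<Rightarrow> bool" where
  "multiplicity_free n B \<longleftrightarrow>
     B \<in> carrier_mat n n \<and> diagonalizable_mat B \<and>
     (\<forall>\<theta>. eigenvalue B \<theta> \<longrightarrow> kernel_dim (char_matrix B \<theta>) = 1)"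

definition is_primitive_idempotent :: "nat \<Rightarrow> 'a::field mat \<Rightarrow> 'a \<Rightarrow> 'a mat \<Rightarrow> bool" where
  "is_primitive_idempotent n B \<theta> E \<longleftrightarrow>
     E \<in> carrier_mat n n \<and> eigenvalue B \<theta> \<and>
     (\<forall>v \<in> eigenspace B \<theta>. E *\<^sub>v v = v) \<and>
     (\<forall>\<theta>'. eigenvalue B \<theta>' \<and> \<theta>' \<noteq> \<theta> \<longrightarrow> (\<forall>v \<in> eigenspace B \<theta>'. E *\<^sub>v v = 0\<^sub>v n))"

text \<open>For multiplicity-free \<open>B\<close> and an eigenvalue \<open>\<theta>\<close> of \<open>B\<close> the described matrix exists and
  is unique; otherwise the value is not meaningful.\<close>

definition primitive_idempotent :: "nat \<Rightarrow> 'a::field mat \<Rightarrow> 'a \<Rightarrow> 'a mat" where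
  "primitive_idempotent n B \<theta> = (THE E. is_primitive_idempotent n B \<theta> E)"

definition idempotent_ordering :: "nat \<Rightarrow> 'a::field mat \<Rightarrow> (nat \<Rightarrow> 'a mat) \<Rightarrow> bool" where
  "idempotent_ordering d B E \<longleftrightarrow>
     bij_betw E {0..d} {F. \<exists>\<theta>. is_primitive_idempotent (d + 1) B \<theta> F}"

text \<open>The index conditions are those on the differences \<open>i - j\<close> and \<open>j - i\<close>, written additively
  to avoid truncated subtraction: \<open>1 < i - j\<close> becomes \<open>j + 1 < i\<close>, \<open>1 < j - i < d\<close> becomes
  \<open>i + 1 < j < i + d\<close>, and so on.\<close>

definition circular_pattern :: "nat \<Rightarrow> (nat \<Rightarrow> 'a::field mat) \<Rightarrow> 'a mat \<Rightarrow> bool" where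
  "circular_pattern d E B \<longleftrightarrow>
     (\<forall>i \<le> d. \<forall>j \<le> d.
        (j + 1 < i \<or> (i + 1 < j \<and> j < i + d) \<longrightarrow> E i * B * E j = 0\<^sub>m (d + 1) (d + 1)) \<and>
        (i = j + 1 \<or> j = i + d \<longrightarrow> E i * B * E j \<noteq> 0\<^sub>m (d + 1) (d + 1)))"

definition CH_system ::
  "nat \<Rightarrow> 'a::field mat \<Rightarrow> (nat \<Rightarrow> 'a mat) \<Rightarrow> 'a mat \<Rightarrow> (nat \<Rightarrow> 'a mat) \<Rightarrow> bool" where
  "CH_system d A E A' E' \<longleftrightarrow>
     multiplicity_free (d + 1) A \<and> multiplicity_free (d + 1) A' \<and>
     idempotent_ordering d A E \<and>
     idempotent_ordering d A' E' \<and>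
     circular_pattern d E A' \<and>
     circular_pattern d E' A"

end

theory Submission
  imports Defs
begin

text \<open>One of \<open>A\<close>, \<open>A\<^sup>*\<close> is upper bidiagonal, with eigenvalues \<open>t\<^sub>0, \<dots>, t\<^sub>d\<close> say, and the other is
  lower bidiagonal; so in an eigenbasis of the first the second is represented by a Hessenberg
  matrix \<open>M\<close>. The three recurrences yield an Askey-Wilson relation between the two matrices.
  Sandwiching it between eigenvectors gives \<open>P(t\<^sub>i, t\<^sub>j) M\<^sub>i\<^sub>j = 0\<close> for \<open>i \<noteq> j\<close>, where \<open>P\<close> is symmetric
  and \<open>P(t\<^sub>i, y) = (y - t\<^sub>i\<^sub>-\<^sub>1) (y - t\<^sub>i\<^sub>+\<^sub>1)\<close> for \<open>0 < i < d\<close>; hence \<open>M\<close> vanishes above the superdiagonal,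
  the corner excepted.

  For the corner, \<open>\<vartheta>\<^sub>1 \<noteq> \<vartheta>\<^sub>d\<close> together with \<open>\<vartheta>\<^sub>0 = \<vartheta>\<^sub>d\<^sub>+\<^sub>1 = 0\<close> forces every \<open>\<beta>\<close>-recurrent
  sequence to have period \<open>d + 1\<close>. Then \<open>\<vartheta>\<^sub>k = c\<^sub>k (t\<^sub>d - t\<^sub>k\<^sub>-\<^sub>1) - c\<^sub>k\<^sub>-\<^sub>1 (t\<^sub>0 - t\<^sub>k)\<close> for a
  \<open>\<beta>\<close>-recurrent \<open>c\<close>, which telescopes the sum of products giving the corner entry to a nonzero
  multiple of \<open>\<vartheta>\<^sub>1 - \<vartheta>\<^sub>d\<close>.

  The roles of \<open>A\<close> and \<open>A\<^sup>*\<close> are exchanged by reversing the order of the standard basis.\<close>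

section \<open>Recurrent sequences\<close>

text \<open>The recurrence is demanded at every index, without the end conditions of
  \<open>beta_recurrent\<close>, so that three consecutive values determine a solution and shifts of
  solutions are solutions.\<close>

definition recurrent :: "'a::field \<Rightarrow> (nat \<Rightarrow> 'a) \<Rightarrow> bool" where
  "recurrent \<beta> \<sigma> \<longleftrightarrow> (\<forall>k. \<sigma> (k + 3) = \<sigma> k - (\<beta> + 1) * \<sigma> (k + 1) + (\<beta> + 1) * \<sigma> (k + 2))"

lemma recurrentD:
  assumes "recurrent \<beta> \<sigma>"
  shows "\<sigma> (k + 3) = \<sigma> k - (\<beta> + 1) * \<sigma> (k + 1) + (\<beta> + 1) * \<sigma> (k + 2)"
  using assms unfolding recurrent_def by blast

lemma recurrent_eq:
  assumes "recurrent \<beta> \<sigma>" "recurrent \<beta> \<tau>" "\<sigma> 0 = \<tau> 0" "\<sigma> 1 = \<tau> 1" "\<sigma> 2 = \<tau> 2"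
  shows "\<sigma> k = \<tau> k"
proof -
  have "\<sigma> k = \<tau> k \<and> \<sigma> (k + 1) = \<tau> (k + 1) \<and> \<sigma> (k + 2) = \<tau> (k + 2)"
  proof (induction k)
    case 0
    then show ?case using assms(3-5) by (simp add: numeral_2_eq_2)
  next
    case (Suc k)
    then show ?case
      using recurrentD[OF assms(1), of k] recurrentD[OF assms(2), of k]
      by (simp add: numeral_eq_Suc)
  qed
  then show ?thesis by simp
qed

lemma recurrent_shift:
  assumes "recurrent \<beta> \<sigma>"
  shows "recurrent \<beta> (\<lambda>k. \<sigma> (k + m))"
  unfolding recurrent_def
proof
  show "\<sigma> (k + 3 + m) = \<sigma> (k + m) - (\<beta> + 1) * \<sigma> (k + 1 + m) + (\<beta> + 1) * \<sigma> (k + 2 + m)" for k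
    using recurrentD[OF assms, of "k + m"] by (simp only: ac_simps)
qed

fun rec_seq :: "'a::field \<Rightarrow> 'a \<Rightarrow> 'a \<Rightarrow> 'a \<Rightarrow> nat \<Rightarrow> 'a" where
  "rec_seq \<beta> a b c 0 = a"
| "rec_seq \<beta> a b c (Suc 0) = b"
| "rec_seq \<beta> a b c (Suc (Suc 0)) = c"
| "rec_seq \<beta> a b c (Suc (Suc (Suc k))) =
     rec_seq \<beta> a b c k - (\<beta> + 1) * rec_seq \<beta> a b c (Suc k) + (\<beta> + 1) * rec_seq \<beta> a b c (Suc (Suc k))"

lemma recurrent_rec_seq: "recurrent \<beta> (rec_seq \<beta> a b c)"
  unfolding recurrent_def by (simp add: numeral_eq_Suc)

text \<open>Continuing a finite sequence by the recurrence removes the bound on the indices. The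
  values beyond \<open>n\<close> are artificial, but every identity for \<open>recurrent\<close>
  sequences applies to them.\<close>

lemma beta_recurrent_extend:
  assumes "beta_recurrent \<beta> n \<sigma>"
  shows "\<exists>\<tau>. recurrent \<beta> \<tau> \<and> (\<forall>k\<le>n. \<tau> k = \<sigma> k)"
proof (intro exI conjI allI impI)
  let ?\<tau> = "rec_seq \<beta> (\<sigma> 0) (\<sigma> 1) (\<sigma> 2)"
  show "recurrent \<beta> ?\<tau>" by (rule recurrent_rec_seq)
  show "?\<tau> k = \<sigma> k" if "k \<le> n" for k
    using that
  proof (induction k rule: less_induct)
    case (less k)
    show ?case
    proof (cases "k < 3")
      case True
      then have "k = 0 \<or> k = 1 \<or> k = 2" by linarith
      then show ?thesis by (auto simp: numeral_2_eq_2)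
    next
      case False
      then obtain m where m: "k = m + 3" by (metis add.commute le_Suc_ex not_less)
      have "2 \<le> m + 2 \<and> m + 2 \<le> n - 1" using less.prems m by simp
      from assms[unfolded beta_recurrent_def, rule_format, OF this]
      have "\<sigma> k = \<sigma> m - (\<beta> + 1) * \<sigma> (m + 1) + (\<beta> + 1) * \<sigma> (m + 2)"
        unfolding m by (simp add: numeral_3_eq_3)
      then show ?thesis
        using m less by (simp add: recurrentD[OF recurrent_rec_seq])
    qed
  qed
qed

text \<open>The coefficients 1, -(\<beta> + 1), \<beta> + 1, -1 only change sign when read
  backwards.\<close>

lemma beta_recurrent_rev:
  assumes "beta_recurrent \<beta> n \<sigma>"
  shows "beta_recurrent \<beta> n (\<lambda>k. \<sigma> (n - k))"
  unfolding beta_recurrent_def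
proof (intro allI impI)
  fix i assume i: "2 \<le> i \<and> i \<le> n - 1"
  \<comment> \<open>Reflection carries the window \<open>i - 2, ..., i + 1\<close> to
    \<open>j - 2, ..., j + 1\<close>.\<close>
  define j where "j = n - i + 1"
  have "n - (i - 2) = j + 1" "n - (i - 1) = j" "n - i = j - 1" "n - (i + 1) = j - 2" "2 \<le> j" "j \<le> n - 1"
    using i unfolding j_def by auto
  then show "\<sigma> (n - (i - 2)) - (\<beta> + 1) * \<sigma> (n - (i - 1)) + (\<beta> + 1) * \<sigma> (n - i) - \<sigma> (n - (i + 1)) = 0"
    using assms[unfolded beta_recurrent_def, rule_format, of j] by (simp add: algebra_simps)
qed

text \<open>Chebyshev-type sequences: for \<beta> = q + 1/q the initial values 2, \<beta> give q^j +
  q^(-j), and 1, \<beta> - 1 give the alternating sum q^j - q^(j-1) + ... + q^(-j).\<close>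

fun rec_seq2 :: "'a::field \<Rightarrow> 'a \<Rightarrow> 'a \<Rightarrow> nat \<Rightarrow> 'a" where
  "rec_seq2 \<beta> a b 0 = a"
| "rec_seq2 \<beta> a b (Suc 0) = b"
| "rec_seq2 \<beta> a b (Suc (Suc k)) = \<beta> * rec_seq2 \<beta> a b (Suc k) - rec_seq2 \<beta> a b k"

text \<open>An odd number of terms has a middle one. The sums \<open>D (m - j) + D (m + j)\<close>
  satisfy in \<open>j\<close> the same recurrence as \<open>D\<close>, starting from
  \<open>2 * D m\<close> and \<open>\<beta> * D m\<close>; the window consists of \<open>D m\<close>
  and such pairs.\<close>

lemma sum_window_odd:
  fixes D :: "nat \<Rightarrow> 'a::field"
  assumes D: "\<And>k. D (k + 2) = \<beta> * D (k + 1) - D k"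
  shows "D 0 + D (2 * m) = rec_seq2 \<beta> 2 \<beta> m * D m"
    and "(\<Sum>k\<le>2 * m. D k) = (1 + (\<Sum>j=1..m. rec_seq2 \<beta> 2 \<beta> j)) * D m"
proof -
  have pair: "j \<le> m \<Longrightarrow> D (m - j) + D (m + j) = rec_seq2 \<beta> 2 \<beta> j * D m" for j
  proof (induction j rule: induct_nat_012)
    case 1
    then show ?case using D[of "m - 1"] by simp
  next
    case (ge2 j)
    have "D (m - j) = \<beta> * D (m - Suc j) - D (m - Suc (Suc j))"
      using D[of "m - Suc (Suc j)"] ge2(3) by (simp add: Suc_diff_Suc numeral_eq_Suc)
    moreover have "D (m + Suc (Suc j)) = \<beta> * D (m + Suc j) - D (m + j)"
      using D[of "m + j"] by simp
    ultimately have "D (m - Suc (Suc j)) + D (m + Suc (Suc j))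
        = \<beta> * (D (m - Suc j) + D (m + Suc j)) - (D (m - j) + D (m + j))"
      by (simp add: algebra_simps)
    then show ?case using ge2 by (simp add: left_diff_distrib)
  qed simp
  show "D 0 + D (2 * m) = rec_seq2 \<beta> 2 \<beta> m * D m"
    using pair[of m] by (simp add: mult_2)
  have "r \<le> m \<Longrightarrow> (\<Sum>k=m - r..m + r. D k) = (1 + (\<Sum>j=1..r. rec_seq2 \<beta> 2 \<beta> j)) * D m" for r
  proof (induction r)
    case (Suc r)
    have "(\<Sum>k=m - Suc r..m + Suc r. D k) = D (m - Suc r) + (\<Sum>k=m - r..m + r. D k) + D (m + Suc r)"
      using Suc.prems by (simp add: sum.atLeast_Suc_atMost Suc_diff_Suc)
    then show ?case using Suc pair[of "Suc r"] by (simp add: algebra_simps)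
  qed simp
  from this[of m] show "(\<Sum>k\<le>2 * m. D k) = (1 + (\<Sum>j=1..m. rec_seq2 \<beta> 2 \<beta> j)) * D m"
    by (simp add: mult_2 atMost_atLeast0)
qed

text \<open>The middle is now the pair with sum S = \<open>D m + D (m + 1)\<close>, and
  \<open>D (m - j) + D (m + 1 + j)\<close> follows the recurrence from S and (\<beta> - 1)
  S.\<close>

lemma sum_window_even:
  fixes D :: "nat \<Rightarrow> 'a::field"
  assumes D: "\<And>k. D (k + 2) = \<beta> * D (k + 1) - D k"
  shows "D 0 + D (2 * m + 1) = rec_seq2 \<beta> 1 (\<beta> - 1) m * (D m + D (m + 1))"
    and "(\<Sum>k\<le>2 * m + 1. D k) = (\<Sum>j=0..m. rec_seq2 \<beta> 1 (\<beta> - 1) j) * (D m + D (m + 1))"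
proof -
  have pair: "j \<le> m \<Longrightarrow> D (m - j) + D (m + 1 + j) = rec_seq2 \<beta> 1 (\<beta> - 1) j * (D m + D (m + 1))" for j
  proof (induction j rule: induct_nat_012)
    case 1
    then show ?case using D[of "m - 1"] D[of m] by (simp add: algebra_simps)
  next
    case (ge2 j)
    have "D (m - j) = \<beta> * D (m - Suc j) - D (m - Suc (Suc j))"
      using D[of "m - Suc (Suc j)"] ge2(3) by (simp add: Suc_diff_Suc numeral_eq_Suc)
    moreover have "D (m + 1 + Suc (Suc j)) = \<beta> * D (m + 1 + Suc j) - D (m + 1 + j)"
      using D[of "m + 1 + j"] by simp
    ultimately have "D (m - Suc (Suc j)) + D (m + 1 + Suc (Suc j))
        = \<beta> * (D (m - Suc j) + D (m + 1 + Suc j)) - (D (m - j) + D (m + 1 + j))"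
      by (simp add: algebra_simps)
    then show ?case using ge2 by (simp add: left_diff_distrib)
  qed simp
  show "D 0 + D (2 * m + 1) = rec_seq2 \<beta> 1 (\<beta> - 1) m * (D m + D (m + 1))"
    using pair[of m] by (simp add: mult_2)
  have "r \<le> m \<Longrightarrow> (\<Sum>k=m - r..m + 1 + r. D k) = (\<Sum>j=0..r. rec_seq2 \<beta> 1 (\<beta> - 1) j) * (D m + D (m + 1))" for r
  proof (induction r)
    case (Suc r)
    have "(\<Sum>k=m - Suc r..m + 1 + Suc r. D k) = D (m - Suc r) + (\<Sum>k=m - r..m + 1 + r. D k) + D (m + 1 + Suc r)"
      using Suc.prems by (simp add: sum.atLeast_Suc_atMost Suc_diff_Suc) arith
    then show ?case using Suc pair[of "Suc r"] by (simp add: algebra_simps)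
  qed simp
  from this[of m] show "(\<Sum>k\<le>2 * m + 1. D k) = (\<Sum>j=0..m. rec_seq2 \<beta> 1 (\<beta> - 1) j) * (D m + D (m + 1))"
    by (simp add: mult_2 atMost_atLeast0)
qed

text \<open>Pairing the terms at \<open>k\<close> and \<open>d - k\<close> shows that both \<open>D 0 + D d\<close> and the sum are multiples,
  by factors depending only on \<open>\<beta>\<close> and \<open>d\<close>, of the same middle value. Splitting by the parity of \<open>d\<close>
  avoids a division by 2, so characteristic 2 is covered.\<close>

lemma sum_window_zero:
  fixes D E :: "nat \<Rightarrow> 'a::field"
  assumes D: "\<And>k. D (k + 2) = \<beta> * D (k + 1) - D k" and E: "\<And>k. E (k + 2) = \<beta> * E (k + 1) - E k"
    and "(\<Sum>k\<le>d. D k) = 0" "D 0 + D d \<noteq> 0"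
  shows "(\<Sum>k\<le>d. E k) = 0"
proof (cases "even d")
  case True
  then obtain m where "d = 2 * m" by blast
  with assms(3,4) sum_window_odd[of D \<beta> m, OF D] sum_window_odd[of E \<beta> m, OF E]
  show ?thesis by auto
next
  case False
  then obtain m where "d = 2 * m + 1" using oddE by blast
  with assms(3,4) sum_window_even[of D \<beta> m, OF D] sum_window_even[of E \<beta> m, OF E]
  show ?thesis by (metis mult_eq_0_iff)
qed

text \<open>Since x^3 - (\<beta> + 1) x^2 + (\<beta> + 1) x - 1 = (x - 1) (x^2 - \<beta> x + 1), the
  quantity \<open>\<sigma> (k + 2) - \<beta> * \<sigma> (k + 1) + \<sigma> k\<close> is constant in
  \<open>k\<close>.\<close>

lemma recurrent_second_order:
  assumes "recurrent \<beta> \<sigma>"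
  shows "\<exists>g. \<forall>k. \<sigma> (k + 2) = \<beta> * \<sigma> (k + 1) - \<sigma> k + g"
proof (intro exI allI)
  define g where "g = \<sigma> 2 - \<beta> * \<sigma> 1 + \<sigma> 0"
  show "\<sigma> (k + 2) = \<beta> * \<sigma> (k + 1) - \<sigma> k + g" for k
  proof (induction k)
    case (Suc k)
    have "\<sigma> (Suc k + 2) = \<sigma> k - (\<beta> + 1) * \<sigma> (Suc k) + (\<beta> + 1) * \<sigma> (k + 2)"
      using recurrentD[OF assms, of k] by (simp add: numeral_eq_Suc)
    then have "\<sigma> (Suc k + 2) = \<beta> * \<sigma> (k + 2) - \<sigma> (Suc k) + (\<sigma> (k + 2) + \<sigma> k - \<beta> * \<sigma> (Suc k))"
      by (simp add: algebra_simps)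
    moreover have "\<sigma> (k + 2) + \<sigma> k - \<beta> * \<sigma> (Suc k) = g" using Suc by simp
    ultimately show ?case by simp
  qed (simp add: g_def numeral_2_eq_2)
qed

text \<open>The differences of \<open>v\<close> satisfy the homogeneous second-order recurrence.
  Those at 0, ..., \<open>d\<close> telescope to 0, while the first and the last add up to
  \<open>v 1 - v d\<close>, which is nonzero; \<open>sum_window_zero\<close> then makes the
  differences of \<open>\<sigma>\<close> over any window of this length sum to 0.\<close>

lemma recurrent_periodic:
  assumes v: "recurrent \<beta> v" and \<sigma>: "recurrent \<beta> \<sigma>"
    and "v 0 = 0" "v (d + 1) = 0" "v 1 \<noteq> v d"
  shows "\<sigma> (k + (d + 1)) = \<sigma> k"
proof -
  have diff: "\<tau> (i + 2 + 1) - \<tau> (i + 2) = \<beta> * (\<tau> (i + 1 + 1) - \<tau> (i + 1)) - (\<tau> (i + 1) - \<tau> i)"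
    if "recurrent \<beta> \<tau>" for \<tau> i
    using recurrentD[OF that, of i] by (simp add: algebra_simps numeral_eq_Suc)
  have tel: "(\<Sum>i\<le>d. \<tau> (i + 1) - \<tau> i) = \<tau> (d + 1) - \<tau> 0" for \<tau> :: "nat \<Rightarrow> 'a"
    by (induction d) simp_all
  have "(\<Sum>i\<le>d. \<sigma> (i + 1 + k) - \<sigma> (i + k)) = 0"
  proof (rule sum_window_zero[of "\<lambda>i. v (i + 1) - v i" \<beta>])
    show "(\<Sum>i\<le>d. v (i + 1) - v i) = 0" using tel[of v] assms by simp
    show "v (0 + 1) - v 0 + (v (d + 1) - v d) \<noteq> 0" using assms by simp
  qed (rule diff[OF v] diff[OF recurrent_shift[OF \<sigma>]])+
  then show ?thesis using tel[of "\<lambda>i. \<sigma> (i + k)"] by (simp add: add.commute add.left_commute)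
qed

text \<open>The characteristic roots 1, q, 1/q with q + 1/q = \<beta> are permuted by forming
  products of two of them, so the 2 by 2 minors of consecutive terms of two solutions obey the same
  recurrence. The terms with \<open>a\<close> and \<open>b\<close> are linear in
  \<open>c\<close>.\<close>

lemma recurrent_wedge:
  assumes c: "recurrent \<beta> c" and t: "recurrent \<beta> t"
  shows "recurrent \<beta> (\<lambda>k. c (k + 1) * (a - t k) - c k * (b - t (k + 1)))"
  unfolding recurrent_def
proof
  fix k :: nat
  have idx: "k + 3 + 1 = k + 4" "k + 1 + 1 = k + 2" "k + 2 + 1 = k + 3" by simp_all
  have c4: "c (k + 4) = c (k + 1) - (\<beta> + 1) * c (k + 2) + (\<beta> + 1) * c (k + 3)"
    and t4: "t (k + 4) = t (k + 1) - (\<beta> + 1) * t (k + 2) + (\<beta> + 1) * t (k + 3)"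
    using recurrentD[OF c, of "k + 1"] recurrentD[OF t, of "k + 1"] by (simp_all add: numeral_eq_Suc)
  show "c (k + 3 + 1) * (a - t (k + 3)) - c (k + 3) * (b - t (k + 3 + 1)) =
     c (k + 1) * (a - t k) - c k * (b - t (k + 1))
     - (\<beta> + 1) * (c (k + 1 + 1) * (a - t (k + 1)) - c (k + 1) * (b - t (k + 1 + 1)))
     + (\<beta> + 1) * (c (k + 2 + 1) * (a - t (k + 2)) - c (k + 2) * (b - t (k + 2 + 1)))"
    unfolding idx c4 t4 recurrentD[OF c, of k] recurrentD[OF t, of k]
    by (simp add: algebra_simps)
qed

text \<open>Both sides solve the recurrence in \<open>k\<close>, so agreement at three consecutive
  indices suffices. The indices \<open>d - 1\<close>, \<open>d\<close>, \<open>d + 1\<close> are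
  used, where periodicity and the zeros of \<open>c\<close> simplify the terms.\<close>

lemma recurrent_wedge_decomposition:
  assumes t: "recurrent \<beta> t" and v: "recurrent \<beta> v"
    and v0: "v 0 = 0" "v (d + 1) = 0" and v1: "v 1 \<noteq> v d" and d: "1 \<le> d"
    and td: "t d \<noteq> t 0" "t d \<noteq> t 1"
  shows "\<exists>c. c 0 = 0 \<and> c d = (v 1 - v d) / (t 1 - t d) \<and>
    (\<forall>k. v (k + 1) = c (k + 1) * (t d - t k) - c k * (t 0 - t (k + 1)))"
proof -
  \<comment> \<open>Forced by the comparison: index \<open>d + 1\<close> determines
    \<open>c1\<close>, and index \<open>d - 1\<close> then determines \<open>cd\<close>.\<close>
  define c1 cd where "c1 = v 1 / (t d - t 0)" and "cd = (v 1 - v d) / (t 1 - t d)"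
  \<comment> \<open>\<open>c\<close> is the periodic solution with \<open>c (-1) = cd\<close>, \<open>c 0 = 0\<close>, \<open>c 1 = c1\<close>.\<close>
  define c where "c = rec_seq \<beta> 0 c1 (cd + (\<beta> + 1) * c1)"
  note per = recurrent_periodic[OF v _ v0 v1]
  have c: "recurrent \<beta> c" unfolding c_def by (rule recurrent_rec_seq)
  have c0: "c 0 = 0" "c 1 = c1" "c 2 = cd + (\<beta> + 1) * c1"
    unfolding c_def by (simp_all add: numeral_eq_Suc)
  define r where "r = (\<lambda>k. c (k + 1) * (t d - t k) - c k * (t 0 - t (k + 1)))"
  have r: "recurrent \<beta> r" unfolding r_def by (rule recurrent_wedge[OF c t])
  have cper: "c (d + 1) = 0" "c (d + 2) = c1" "c (d + 3) = cd + (\<beta> + 1) * c1"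
    using per[OF c, of 0] per[OF c, of 1] per[OF c, of 2] c0 by (simp_all add: add.commute numeral_eq_Suc)
  have tper: "t (d + 1) = t 0" "t (d + 2) = t 1"
    using per[OF t, of 0] per[OF t, of 1] by (simp_all add: add.commute numeral_eq_Suc)
  have vper: "v (d + 2) = v 1" using per[OF v, of 1] by (simp add: add.commute numeral_eq_Suc)
  have cd: "c d = cd" using recurrentD[OF c, of d] cper by (simp add: algebra_simps)
  obtain e where e: "d = e + 1" using d by (metis add.commute le_Suc_ex)
  have ce: "c e = c1 + (\<beta> + 1) * cd" 
    using recurrentD[OF c, of e] cper cd unfolding e by (simp add: numeral_eq_Suc algebra_simps)
  have te: "t e = t 1 - (\<beta> + 1) * t 0 + (\<beta> + 1) * t d"
    using recurrentD[OF t, of e] tper unfolding e by (simp add: numeral_eq_Suc algebra_simps)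
  have nz: "t d - t 0 \<noteq> 0" "t 1 - t d \<noteq> 0" using td by auto
  have eqs: "c1 * (t d - t 0) = v 1" "cd * (t 1 - t d) = v 1 - v d"
    using nz unfolding c1_def cd_def by simp_all
  have "r e = cd * (t d - t e) - c e * (t 0 - t d)"
    unfolding r_def using cd by (simp add: e)
  also have "\<dots> = c1 * (t d - t 0) - cd * (t 1 - t d)" unfolding ce te by (simp add: algebra_simps)
  also have "\<dots> = v d" using eqs by simp
  finally have re: "r e = v (e + 1)" using e by simp
  have re1: "r (e + 1) = v (e + 2)" unfolding r_def using cd e cper v0 tper by (simp add: e)
  have re2: "r (e + 2) = v (e + 3)" unfolding r_def using cper v0 tper eqs vper by (simp add: e numeral_eq_Suc)
  \<comment> \<open>The two sequences agree from index \<open>e\<close> on; periodicity will carry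
    this back to index 0.\<close>
  have "r (k + e) = v (k + (e + 1))" for k
    by (rule recurrent_eq[OF recurrent_shift[OF r] recurrent_shift[OF v]])
      (use re re1 re2 in \<open>simp_all add: add.commute numeral_eq_Suc\<close>)
  moreover have "k + 2 + e = k + (d + 1)" "k + 2 + (e + 1) = k + 1 + (d + 1)" for k
    using e by simp_all
  ultimately have "r (k + (d + 1)) = v (k + 1 + (d + 1))" for k by metis
  then have "r k = v (k + 1)" for k
    using per[OF r, of k] per[OF v, of "k + 1"] by metis
  then show ?thesis using c0(1) cd unfolding cd_def r_def by (intro exI[of _ c]) simp
qed

section \<open>Primitive idempotents from an eigenbasis\<close>

lemma mem_eigenspace:
  assumes "B \<in> carrier_mat n n"
  shows "v \<in> eigenspace B e \<longleftrightarrow> v \<in> carrier_vec n \<and> B *\<^sub>v v = e \<cdot>\<^sub>v v"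
proof (cases "v \<in> carrier_vec n")
  case v: True
  have eq: "char_matrix B e *\<^sub>v v = B *\<^sub>v v + (- e) \<cdot>\<^sub>v v"
    unfolding char_matrix_def
    by (rule eq_vecI) (use v assms in \<open>auto simp: add_scalar_prod_distrib[of _ n]\<close>)
  have "char_matrix B e *\<^sub>v v = 0\<^sub>v n \<longleftrightarrow> (\<forall>k<n. (B *\<^sub>v v) $ k - e * v $ k = 0)"
    unfolding eq using v assms by (simp add: vec_eq_iff)
  also have "\<dots> \<longleftrightarrow> B *\<^sub>v v = e \<cdot>\<^sub>v v"
    using v assms by (simp add: vec_eq_iff)
  finally show ?thesis
    using v unfolding eigenspace_def mat_kernel[OF char_matrix_closed[OF assms]] by simp
next
  case False
  then show ?thesis
    unfolding eigenspace_def mat_kernel[OF char_matrix_closed[OF assms]] by simp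
qed

text \<open>The columns of \<open>X\<close> are eigenvectors of \<open>B\<close> and the rows of
  \<open>Y\<close> form the dual basis, so \<open>Y * C * X\<close> represents \<open>C\<close> in
  the eigenbasis. Both matrices are parameters because entries of \<open>Y * C * X\<close> are
  computed later.\<close>

locale eigenbasis =
  fixes n :: nat and B X Y :: "'a::field mat" and f :: "nat \<Rightarrow> 'a"
  assumes B: "B \<in> carrier_mat n n" and X: "X \<in> carrier_mat n n" and Y: "Y \<in> carrier_mat n n"
    and YX: "Y * X = 1\<^sub>m n" and BX: "B * X = X * mat_diag n f" and inj: "inj_on f {..<n}"
begin

lemmas closed = mult_carrier_mat[of _ n n _ n]
lemmas assoc = assoc_mult_mat[of _ n n _ n _ n]

lemma XY: "X * Y = 1\<^sub>m n"
  by (rule mat_mult_left_right_inverse[OF Y X YX])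

lemma B_eq: "B = X * mat_diag n f * Y"
proof -
  have "B = B * (X * Y)" using B XY by simp
  also have "\<dots> = X * mat_diag n f * Y" using assoc_mult_mat[OF B X Y] BX by simp
  finally show ?thesis .
qed

lemma Y_mult_B: "Y * B = mat_diag n f * Y"
proof -
  have "Y * B = Y * (X * (mat_diag n f * Y))"
    using X Y by (simp add: B_eq assoc_mult_mat[of _ n n _ n _ n])
  also have "\<dots> = (Y * X) * (mat_diag n f * Y)"
    using X Y by (simp add: assoc_mult_mat[of Y n n X n _ n] closed)
  also have "\<dots> = mat_diag n f * Y"
    using Y unfolding YX by (simp add: left_mult_one_mat[of _ n n] closed)
  finally show ?thesis .
qed

lemma Y_mult_vec: "v \<in> carrier_vec n \<Longrightarrow> Y *\<^sub>v v \<in> carrier_vec n"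
  using Y by simp

lemma X_Y_vec: "v \<in> carrier_vec n \<Longrightarrow> X *\<^sub>v (Y *\<^sub>v v) = v"
  using XY X Y by (metis assoc_mult_mat_vec one_mult_mat_vec)

lemma mat_diag_mult_vec:
  "w \<in> carrier_vec n \<Longrightarrow> mat_diag n g *\<^sub>v w = vec n (\<lambda>k. g k * w $ k)"
  by (rule eq_vecI) (auto simp: mat_diag_def scalar_prod_def if_distrib if_distribR sum.delta cong: if_cong)

text \<open>In the coordinates \<open>Y *\<^sub>v v\<close> the map \<open>B\<close> is diagonal, so
  the eigenvalue equation decouples.\<close>

lemma mem_eigenspace_iff:
  "v \<in> eigenspace B e \<longleftrightarrow> v \<in> carrier_vec n \<and> (\<forall>k<n. f k \<noteq> e \<longrightarrow> (Y *\<^sub>v v) $ k = 0)"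
proof (cases "v \<in> carrier_vec n")
  case v: True
  have YBv: "Y *\<^sub>v (B *\<^sub>v v) = vec n (\<lambda>k. f k * (Y *\<^sub>v v) $ k)"
  proof -
    have "Y *\<^sub>v (B *\<^sub>v v) = mat_diag n f *\<^sub>v (Y *\<^sub>v v)"
      using Y B v Y_mult_B by (metis assoc_mult_mat_vec mat_diag_dim)
    then show ?thesis using mat_diag_mult_vec[OF Y_mult_vec[OF v]] by simp
  qed
  have "B *\<^sub>v v = e \<cdot>\<^sub>v v \<longleftrightarrow> Y *\<^sub>v (B *\<^sub>v v) = e \<cdot>\<^sub>v (Y *\<^sub>v v)"
  proof
    assume "Y *\<^sub>v (B *\<^sub>v v) = e \<cdot>\<^sub>v (Y *\<^sub>v v)"
    then have "X *\<^sub>v (Y *\<^sub>v (B *\<^sub>v v)) = X *\<^sub>v (e \<cdot>\<^sub>v (Y *\<^sub>v v))" by simp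
    then show "B *\<^sub>v v = e \<cdot>\<^sub>v v"
      using X_Y_vec[of "B *\<^sub>v v"] X_Y_vec[OF v] mult_mat_vec[OF X Y_mult_vec[OF v]] B v by simp
  qed (use mult_mat_vec[OF Y v] in simp)
  also have "\<dots> \<longleftrightarrow> (\<forall>k<n. f k * (Y *\<^sub>v v) $ k = e * (Y *\<^sub>v v) $ k)"
    unfolding YBv
  proof -
    have "vec n (\<lambda>k. f k * w $ k) = e \<cdot>\<^sub>v w \<longleftrightarrow> (\<forall>k<n. f k * w $ k = e * w $ k)"
      if "w \<in> carrier_vec n" for w
      using that by (auto simp: vec_eq_iff)
    then show "vec n (\<lambda>k. f k * (Y *\<^sub>v v) $ k) = e \<cdot>\<^sub>v (Y *\<^sub>v v) \<longleftrightarrow>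
        (\<forall>k<n. f k * (Y *\<^sub>v v) $ k = e * (Y *\<^sub>v v) $ k)"
      using Y_mult_vec[OF v] by blast
  qed
  finally show ?thesis using mem_eigenspace[OF B] v by auto
qed (use mem_eigenspace[OF B] in simp)

lemma Y_col_X: "k < n \<Longrightarrow> Y *\<^sub>v col X k = unit_vec n k"
  using col_mult2[OF Y X, of k] YX by simp

lemma col_X_carrier: "k < n \<Longrightarrow> col X k \<in> carrier_vec n"
  using X by auto

lemma col_X_nonzero:
  assumes "k < n"
  shows "col X k \<noteq> 0\<^sub>v n"
proof
  assume "col X k = 0\<^sub>v n"
  moreover have "Y *\<^sub>v 0\<^sub>v n = 0\<^sub>v n" using Y by (intro eq_vecI) auto
  ultimately have "unit_vec n k = (0\<^sub>v n :: 'a vec)" using Y_col_X[OF assms] by simp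
  then show False using assms by (metis index_unit_vec(2) index_zero_vec(1) zero_neq_one)
qed

lemma col_X_eigenspace: "k < n \<Longrightarrow> col X k \<in> eigenspace B (f k)"
  using Y_col_X[of k] col_X_carrier[of k] by (auto simp: mem_eigenspace_iff)

lemma eigenvalue_iff: "eigenvalue B e \<longleftrightarrow> (\<exists>k<n. e = f k)"
proof
  assume "eigenvalue B e"
  then obtain v where v: "v \<in> carrier_vec n" "v \<noteq> 0\<^sub>v n" "B *\<^sub>v v = e \<cdot>\<^sub>v v"
    using B unfolding eigenvalue_def eigenvector_def by auto
  show "\<exists>k<n. e = f k"
  proof (rule ccontr)
    assume "\<not> (\<exists>k<n. e = f k)"
    moreover have "\<forall>k<n. f k \<noteq> e \<longrightarrow> (Y *\<^sub>v v) $ k = 0"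
      using mem_eigenspace_iff[of v e] mem_eigenspace[OF B] v by blast
    ultimately have "Y *\<^sub>v v = 0\<^sub>v n" using Y v(1) by (intro eq_vecI) auto
    then show False using X_Y_vec[OF v(1)] X v(2) by auto
  qed
next
  assume "\<exists>k<n. e = f k"
  then obtain k where k: "k < n" "e = f k" by blast
  then have "eigenvector B (col X k) e"
    using col_X_eigenspace[of k] col_X_nonzero[of k] mem_eigenspace[OF B] B
    unfolding eigenvector_def by auto
  then show "eigenvalue B e" unfolding eigenvalue_def by blast
qed

lemma eigenspace_multiple:
  assumes i: "i < n" and v: "v \<in> eigenspace B (f i)"
  shows "v = (Y *\<^sub>v v) $ i \<cdot>\<^sub>v col X i"
proof -
  have vc: "v \<in> carrier_vec n" using v mem_eigenspace_iff by blast
  have "(Y *\<^sub>v v) $ k = 0" if "k < n" "k \<noteq> i" for k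
    using v i that inj mem_eigenspace_iff unfolding inj_on_def by blast
  then have "Y *\<^sub>v v = (Y *\<^sub>v v) $ i \<cdot>\<^sub>v unit_vec n i"
    using Y vc i by (intro eq_vecI) (auto simp: unit_vec_def)
  then have "X *\<^sub>v (Y *\<^sub>v v) = X *\<^sub>v ((Y *\<^sub>v v) $ i \<cdot>\<^sub>v unit_vec n i)" by simp
  also have "\<dots> = (Y *\<^sub>v v) $ i \<cdot>\<^sub>v (X *\<^sub>v (Y *\<^sub>v col X i))"
    using mult_mat_vec[OF X, of "unit_vec n i"] i Y_col_X[of i] by simp
  finally show ?thesis using X_Y_vec[OF vc] X_Y_vec[OF col_X_carrier[OF i]] by simp
qed

lemma multiplicity_free: "multiplicity_free n B"
  unfolding multiplicity_free_def
proof (intro conjI allI impI)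
  show "B \<in> carrier_mat n n" by (rule B)
  show "diagonalizable_mat B"
    unfolding diagonalizable_mat_def
  proof (intro exI conjI)
    show "diagonal_mat (mat_diag n f)" by (auto simp: diagonal_mat_def mat_diag_def)
    show "similar_mat B (mat_diag n f)"
      by (rule similar_matI[OF _ XY YX B_eq]) (use B X Y in auto)
  qed
  fix e assume "eigenvalue B e"
  then obtain i where i: "i < n" "e = f i" using eigenvalue_iff by blast
  interpret K: kernel n n "char_matrix B e" by unfold_locales (use B in simp)
  let ?v = "col X i"
  have ker: "mat_kernel (char_matrix B e) = eigenspace B (f i)"
    using i by (simp add: eigenspace_def)
  have v: "?v \<in> mat_kernel (char_matrix B e)" using col_X_eigenspace[OF i(1)] ker by simp
  have "K.dim = 1"
  proof (rule K.Ker.dim1I)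
    have "w \<in> K.span {?v}" if "w \<in> mat_kernel (char_matrix B e)" for w
    proof -
      \<comment> \<open>Span membership is shown in the full space \<open>K.NC\<close> and then
        transferred to the kernel by \<open>K.span_same\<close>.\<close>
      have "?v \<in> K.NC.span {?v}" using col_X_carrier[OF i(1)] by (intro K.NC.span_mem) auto
      then have "(Y *\<^sub>v w) $ i \<cdot>\<^sub>v ?v \<in> K.NC.span {?v}"
        using col_X_carrier[OF i(1)] by (intro K.NC.smult_in_span) auto
      then show ?thesis
        using eigenspace_multiple[OF i(1), of w] that ker K.span_same[of "{?v}"] v by simp
    qed
    moreover have "K.span {?v} \<subseteq> mat_kernel (char_matrix B e)"
      using v by (intro K.Ker.span_is_subset2) auto
    ultimately show "K.span {?v} = mat_kernel (char_matrix B e)" by auto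
  qed (use v col_X_nonzero[OF i(1)] in simp_all)
  then show "kernel_dim (char_matrix B e) = 1" by simp
qed

definition proj :: "nat \<Rightarrow> 'a mat" where
  "proj i = X * mat_diag n (\<lambda>k. if k = i then 1 else 0) * Y"

lemma proj_carrier: "proj i \<in> carrier_mat n n"
  unfolding proj_def using X Y by (intro mult_carrier_mat[of _ n n]) auto

lemma proj_mult_X: "proj i * X = X * mat_diag n (\<lambda>k. if k = i then 1 else 0)"
proof -
  let ?D = "mat_diag n (\<lambda>k. if k = i then 1 else 0) :: 'a mat"
  have "proj i * X = X * ?D * (Y * X)"
    unfolding proj_def by (rule assoc_mult_mat[of _ n n _ n _ n]) (use X Y in \<open>auto intro!: mult_carrier_mat[of _ n n]\<close>)
  then show ?thesis using X YX by (simp add: right_mult_one_mat[of _ n n] closed)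
qed

lemma proj_col: "k < n \<Longrightarrow> proj i *\<^sub>v col X k = (if k = i then col X k else 0\<^sub>v n)"
proof -
  assume k: "k < n"
  have "proj i *\<^sub>v col X k = col (X * mat_diag n (\<lambda>k. if k = i then 1 else 0)) k"
    using col_mult2[OF proj_carrier X k] proj_mult_X by simp
  then show ?thesis using X k by (auto simp: mat_diag_mult_right[OF X] col_def intro!: eq_vecI)
qed

text \<open>A matrix is determined by its action on the columns of \<open>X\<close>. This gives
  existence and uniqueness at once, which makes the description in
  \<open>primitive_idempotent\<close> meaningful.\<close>

lemma primitive_idempotent_iff:
  assumes i: "i < n"
  shows "is_primitive_idempotent n B (f i) E \<longleftrightarrow> E = proj i"
proof
  assume E: "is_primitive_idempotent n B (f i) E"
  then have Ec: "E \<in> carrier_mat n n" unfolding is_primitive_idempotent_def by blast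
  have "E *\<^sub>v col X k = proj i *\<^sub>v col X k" if k: "k < n" for k
  proof (cases "k = i")
    case True
    then show ?thesis
      using E col_X_eigenspace[OF k] proj_col[OF k] unfolding is_primitive_idempotent_def by simp
  next
    case False
    then have "f k \<noteq> f i" using inj i k unfolding inj_on_def by blast
    then show ?thesis
      using False E col_X_eigenspace[OF k] proj_col[OF k] eigenvalue_iff k
      unfolding is_primitive_idempotent_def by auto
  qed
  then have "E * X = proj i * X"
    using Ec X proj_carrier[of i] col_mult2[OF Ec X] col_mult2[OF proj_carrier X]
    by (intro mat_col_eqI) auto
  then have "E * (X * Y) = proj i * (X * Y)"
    using assoc_mult_mat[OF Ec X Y] assoc_mult_mat[OF proj_carrier X Y] by metis
  then show "E = proj i" using XY right_mult_one_mat[OF Ec] right_mult_one_mat[OF proj_carrier] by simp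
next
  assume E: "E = proj i"
  have smult: "proj i *\<^sub>v (c \<cdot>\<^sub>v col X k) = c \<cdot>\<^sub>v (if k = i then col X k else 0\<^sub>v n)" if "k < n" for c k
    unfolding mult_mat_vec[OF proj_carrier col_X_carrier[OF that]] proj_col[OF that] ..
  show "is_primitive_idempotent n B (f i) E"
    unfolding is_primitive_idempotent_def E
  proof (intro conjI ballI allI impI)
    show "proj i \<in> carrier_mat n n" by (rule proj_carrier)
    show "eigenvalue B (f i)" using eigenvalue_iff i by blast
    show "proj i *\<^sub>v v = v" if "v \<in> eigenspace B (f i)" for v
      using eigenspace_multiple[OF i that] smult[OF i] by metis
    show "proj i *\<^sub>v v = 0\<^sub>v n" if e: "eigenvalue B e \<and> e \<noteq> f i" and v: "v \<in> eigenspace B e" for e v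
    proof -
      obtain k where k: "k < n" "e = f k" using e eigenvalue_iff by blast
      then have "k \<noteq> i" using e by blast
      have "v = (Y *\<^sub>v v) $ k \<cdot>\<^sub>v col X k" using eigenspace_multiple[OF k(1)] v k(2) by blast
      then have "proj i *\<^sub>v v = (Y *\<^sub>v v) $ k \<cdot>\<^sub>v 0\<^sub>v n"
        using smult[OF k(1)] \<open>k \<noteq> i\<close> by metis
      then show ?thesis by (auto intro!: eq_vecI)
    qed
  qed
qed

lemma primitive_idempotent_eq: "i < n \<Longrightarrow> primitive_idempotent n B (f i) = proj i"
  unfolding primitive_idempotent_def by (rule the_equality) (simp_all add: primitive_idempotent_iff)

lemma proj_inj: "inj_on proj {..<n}"
proof (rule inj_onI)
  fix i j assume i: "i \<in> {..<n}" and eq: "proj i = proj j"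
  show "i = j"
  proof (rule ccontr)
    assume "i \<noteq> j"
    then have "col X i = 0\<^sub>v n" using proj_col[of i i] proj_col[of i j] i eq by simp
    then show False using col_X_nonzero i by simp
  qed
qed

lemma proj_bij: "bij_betw proj {..<n} {F. \<exists>e. is_primitive_idempotent n B e F}"
proof -
  have "proj ` {..<n} = {F. \<exists>e. is_primitive_idempotent n B e F}"
  proof (intro equalityI subsetI)
    fix F assume "F \<in> {F. \<exists>e. is_primitive_idempotent n B e F}"
    then obtain e where e: "is_primitive_idempotent n B e F" by blast
    then obtain i where "i < n" "e = f i" using eigenvalue_iff unfolding is_primitive_idempotent_def by blast
    then show "F \<in> proj ` {..<n}" using e primitive_idempotent_iff by auto
  qed (use primitive_idempotent_iff in blast)
  then show ?thesis using proj_inj by (simp add: bij_betw_def)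
qed

text \<open>The product is \<open>X * N * Y\<close>, where \<open>N\<close> keeps only the entry at
  \<open>(i, j)\<close> of \<open>Y * C * X\<close>, and \<open>X\<close>, \<open>Y\<close> are
  invertible. Circular patterns thus become conditions on matrix entries.\<close>

lemma proj_mult_proj:
  assumes C: "C \<in> carrier_mat n n" and i: "i < n" and j: "j < n"
  shows "proj i * C * proj j = 0\<^sub>m n n \<longleftrightarrow> (Y * C * X) $$ (i, j) = 0"
proof -
  let ?D = "\<lambda>i. mat_diag n (\<lambda>k. if k = i then 1 else 0) :: 'a mat"
  define M where "M = Y * C * X"
  define N where "N = ?D i * M * ?D j"
  have M: "M \<in> carrier_mat n n" unfolding M_def by (simp add: closed X Y C)
  have N: "N \<in> carrier_mat n n" unfolding N_def using M by (intro mult_carrier_mat[of _ n n]) auto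
  have NM: "N = mat n n (\<lambda>(k, l). if k = i \<and> l = j then M $$ (i, j) else 0)"
  proof -
    have "?D i * M \<in> carrier_mat n n" using M by (intro mult_carrier_mat[of _ n n]) auto
    from mat_diag_mult_right[OF this] show ?thesis
      unfolding N_def by (intro eq_matI) (auto simp: mat_diag_mult_left[OF M])
  qed
  have eq: "proj i * C * proj j = X * N * Y"
    unfolding proj_def N_def M_def by (simp add: assoc closed X Y C)
  have "X * N * Y = 0\<^sub>m n n \<longleftrightarrow> N = 0\<^sub>m n n"
  proof
    assume "X * N * Y = 0\<^sub>m n n"
    then have "Y * (X * N * Y) * X = 0\<^sub>m n n" using X Y by simp
    moreover have "Y * (X * N * Y) * X = (Y * X) * N * (Y * X)"
      by (simp add: assoc closed X Y N)
    ultimately show "N = 0\<^sub>m n n" using YX N by simp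
  qed (use X Y in simp)
  also have "\<dots> \<longleftrightarrow> M $$ (i, j) = 0"
  proof
    assume "N = 0\<^sub>m n n"
    then have "N $$ (i, j) = 0" using i j by simp
    then show "M $$ (i, j) = 0" using NM i j by simp
  next
    assume "M $$ (i, j) = 0"
    then show "N = 0\<^sub>m n n" unfolding NM by (auto intro!: eq_matI)
  qed
  finally show ?thesis unfolding eq M_def .
qed

end

section \<open>Bidiagonal pairs\<close>

text \<open>The two sides are the quantity \<open>W\<close> of \<open>wilson_relation\<close> at
  consecutive indices, with \<open>p0, ..., p3\<close> in the role of the parametrized products of
  off-diagonal entries.\<close>

lemma subdiagonal_identity:
  fixes t0 t1 t2 t3 r0 r1 r2 r3 v0 v1 v2 v3 \<beta> g g' a b :: "'a::field"
  assumes "t2 = \<beta> * t1 - t0 + g'" "t3 = \<beta> * t2 - t1 + g'"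
    and "r2 = \<beta> * r1 - r0 + g" "r3 = \<beta> * r2 - r1 + g"
    and "v3 = v0 - (\<beta> + 1) * v1 + (\<beta> + 1) * v2"
    and "p0 = v0 + (t0 - a) * (r0 - b)" "p1 = v1 + (t1 - a) * (r1 - b)"
    and "p2 = v2 + (t2 - a) * (r2 - b)" "p3 = v3 + (t3 - a) * (r3 - b)"
  shows "(t1 + t2) * (r2 + r3) + p1 + p3 - \<beta> * (t1 * r2 + t2 * r3 + p2) - g' * (r2 + r3) - g * (t1 + t2)
       = (t0 + t1) * (r1 + r2) + p0 + p2 - \<beta> * (t0 * r1 + t1 * r2 + p1) - g' * (r1 + r2) - g * (t0 + t1)"
  unfolding assms by (simp add: algebra_simps)


text \<open>Consecutive values differ by \<open>(t (k + 2) - t k) * (t (k + 2) - \<beta> * t (k + 1)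
  + t k - g)\<close>, whose second factor is 0.\<close>

lemma quadratic_invariant:
  fixes t :: "nat \<Rightarrow> 'a::field"
  assumes "\<And>k. t (k + 2) = \<beta> * t (k + 1) - t k + g"
  shows "\<exists>r. \<forall>k. t k * t k - \<beta> * (t k * t (k + 1)) + t (k + 1) * t (k + 1) - g * (t k + t (k + 1)) = r"
proof (intro exI allI)
  let ?q = "\<lambda>k. t k * t k - \<beta> * (t k * t (k + 1)) + t (k + 1) * t (k + 1) - g * (t k + t (k + 1))"
  show "?q k = ?q 0" for k
  proof (induction k)
    case (Suc k)
    have idx: "Suc k = k + 1" "k + 1 + 1 = k + 2" by simp_all
    have "?q (Suc k) = ?q k" unfolding idx assms[of k] by (simp add: algebra_simps)
    with Suc show ?case by simp
  qed simp
qed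

text \<open>Vectors are functions on \<open>nat\<close>. The diagonal of the lower bidiagonal map is \<open>R 1, \<dots>, R (d + 1)\<close>;
  thanks to this shift and to \<open>u (d + 1) = l 0 = 0\<close>, the parametrization of \<open>u k * l k\<close> also holds at
  the ends \<open>k = 0\<close> and \<open>k = d + 1\<close>.\<close>

locale bidiagonal_pair =
  fixes d :: nat and \<beta> :: "'a::field" and t R v u l :: "nat \<Rightarrow> 'a"
  assumes d: "3 \<le> d"
    and t: "recurrent \<beta> t" and R: "recurrent \<beta> R" and v: "recurrent \<beta> v"
    and v_ends: "v 0 = 0" "v (d + 1) = 0" and v_neq: "v 1 \<noteq> v d"
    and inj: "inj_on t {..d}"
    and u_nz: "\<And>k. 1 \<le> k \<Longrightarrow> k \<le> d \<Longrightarrow> u k \<noteq> 0"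
    and l_nz: "\<And>k. 1 \<le> k \<Longrightarrow> k \<le> d \<Longrightarrow> l k \<noteq> 0"
    and u_end: "u (d + 1) = 0" and l_end: "l 0 = 0"
    and ul: "\<And>k. k \<le> d + 1 \<Longrightarrow> u k * l k = v k + (t k - t 0) * (R k - R (d + 1))"
begin

definition upper :: "(nat \<Rightarrow> 'a) \<Rightarrow> nat \<Rightarrow> 'a" where
  "upper x k = t k * x k + u (k + 1) * x (k + 1)"

definition lower :: "(nat \<Rightarrow> 'a) \<Rightarrow> nat \<Rightarrow> 'a" where
  "lower x k = R (k + 1) * x k + l k * x (k - 1)"

text \<open>\<open>xv j\<close> is the right and \<open>yv i\<close> the left eigenvector of
  \<open>upper\<close>, obtained by solving the bidiagonal system one step at a time from the value
  1 at its own index.\<close>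

definition xv :: "nat \<Rightarrow> nat \<Rightarrow> 'a" where
  "xv j k = (if k \<le> j then \<Prod>h=k..<j. u (h + 1) / (t j - t h) else 0)"

definition yv :: "nat \<Rightarrow> nat \<Rightarrow> 'a" where
  "yv i k = (if i \<le> k then \<Prod>h=i+1..k. u h / (t i - t h) else 0)"

text \<open>The coordinate of \<open>z\<close> at \<open>xv i\<close> in the basis
  \<open>xv 0, ..., xv d\<close>.\<close>

definition pairing :: "nat \<Rightarrow> (nat \<Rightarrow> 'a) \<Rightarrow> 'a" where
  "pairing i z = (\<Sum>k\<le>d. yv i k * z k)"

section \<open>Left and right eigenvectors of the upper bidiagonal map\<close>

lemma t_neq: "i \<le> d \<Longrightarrow> j \<le> d \<Longrightarrow> i \<noteq> j \<Longrightarrow> t i - t j \<noteq> 0"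
  using inj unfolding inj_on_def by auto

lemma upper_scale: "upper (\<lambda>k. a * x k) = (\<lambda>k. a * upper x k)"
  by (rule ext) (simp add: upper_def algebra_simps)

lemma lower_scale: "lower (\<lambda>k. a * x k) = (\<lambda>k. a * lower x k)"
  by (rule ext) (simp add: lower_def algebra_simps)

lemma xv_step:
  assumes "j \<le> d" "k < j"
  shows "(t j - t k) * xv j k = u (k + 1) * xv j (k + 1)"
proof -
  have "xv j k = u (k + 1) / (t j - t k) * xv j (k + 1)"
    using assms unfolding xv_def by (subst prod.atLeast_Suc_lessThan) simp_all
  then show ?thesis using assms t_neq[of j k] by simp
qed

lemma yv_step:
  assumes "k < d" "i \<le> k"
  shows "(t i - t (k + 1)) * yv i (k + 1) = u (k + 1) * yv i k"
proof -
  have "yv i (k + 1) = yv i k * (u (k + 1) / (t i - t (k + 1)))"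
    using assms unfolding yv_def by simp
  then show ?thesis using assms t_neq[of i "k + 1"] by simp
qed

lemma upper_xv:
  assumes "j \<le> d"
  shows "upper (xv j) = (\<lambda>k. t j * xv j k)"
proof
  fix k
  consider "k < j" | "k = j" | "k > j" by linarith
  then show "upper (xv j) k = t j * xv j k"
  proof cases
    case 1
    then show ?thesis using xv_step[OF assms 1] by (simp add: upper_def algebra_simps)
  qed (simp_all add: upper_def xv_def)
qed

lemma pairing_upper:
  assumes "i \<le> d"
  shows "pairing i (upper z) = t i * pairing i z"
proof -
  have step: "u (k + 1) * yv i k = (t i - t (k + 1)) * yv i (k + 1)" if "k < d" for k
  proof (cases "i \<le> k")
    case True
    then show ?thesis using yv_step[OF that True] by simp
  qed (cases "i = k + 1"; simp add: yv_def)
  have "(\<Sum>k\<le>d. yv i k * (u (k + 1) * z (k + 1))) = (\<Sum>k<d. yv i k * (u (k + 1) * z (k + 1)))"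
    using u_end by (simp add: lessThan_Suc_atMost[symmetric])
  also have "\<dots> = (\<Sum>k<d. (t i - t (Suc k)) * (yv i (Suc k) * z (Suc k)))"
  proof (rule sum.cong[OF refl])
    fix k assume "k \<in> {..<d}"
    then have "yv i k * (u (k + 1) * z (k + 1)) = u (k + 1) * yv i k * z (k + 1)" by simp
    also have "\<dots> = (t i - t (k + 1)) * yv i (k + 1) * z (k + 1)"
      using step \<open>k \<in> {..<d}\<close> by simp
    finally show "yv i k * (u (k + 1) * z (k + 1)) = (t i - t (Suc k)) * (yv i (Suc k) * z (Suc k))"
      by simp
  qed
  \<comment> \<open>The added term at \<open>k = 0\<close> is 0: either \<open>i = 0\<close> or
    \<open>yv i 0 = 0\<close>.\<close>
  also have "\<dots> = (\<Sum>k\<le>d. (t i - t k) * (yv i k * z k))"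
    unfolding sum.atMost_shift by (simp add: yv_def)
  finally have "pairing i (upper z) = (\<Sum>k\<le>d. t k * (yv i k * z k) + (t i - t k) * (yv i k * z k))"
    unfolding pairing_def upper_def sum.distrib by (simp add: distrib_left sum.distrib ac_simps)
  then show ?thesis unfolding pairing_def by (simp add: left_diff_distrib sum_distrib_left)
qed

lemma pairing_scale: "pairing i (\<lambda>k. a * z k) = a * pairing i z"
  unfolding pairing_def by (simp add: sum_distrib_left ac_simps)

text \<open>Left and right eigenvectors for distinct eigenvalues are orthogonal; for
  \<open>i = j\<close> the supports meet only in \<open>i\<close>.\<close>

lemma pairing_xv:
  assumes "i \<le> d" "j \<le> d"
  shows "pairing i (xv j) = (if i = j then 1 else 0)"
proof (cases "i = j")
  case True
  have "pairing i (xv i) = (\<Sum>k\<in>{i}. yv i k * xv i k)"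
    unfolding pairing_def by (rule sum.mono_neutral_right) (use assms in \<open>auto simp: yv_def xv_def\<close>)
  then show ?thesis using True by (simp add: yv_def xv_def)
next
  case False
  have "t i * pairing i (xv j) = t j * pairing i (xv j)"
    using pairing_upper[OF assms(1), of "xv j"] unfolding upper_xv[OF assms(2)] pairing_scale by (rule sym)
  then have "(t i - t j) * pairing i (xv j) = 0" by (simp add: left_diff_distrib)
  then show ?thesis using t_neq[OF assms False] False by simp
qed

section \<open>The lower bidiagonal map in the eigenbasis of the upper one\<close>

lemma lower_xv_zero: "k > j + 1 \<Longrightarrow> lower (xv j) k = 0"
  by (simp add: lower_def xv_def)

lemma lower_xv_subdiagonal: "lower (xv j) (j + 1) = l (j + 1)"
  by (simp add: lower_def xv_def)

text \<open>\<open>lower (xv j)\<close> is supported on indices up to \<open>j + 1\<close> and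
  \<open>yv i\<close> on indices from \<open>i\<close> on. For \<open>i = j + 1\<close> the supports
  meet in one index, which yields the subdiagonal entry.\<close>

lemma pairing_lower_below:
  assumes "j + 1 < i"
  shows "pairing i (lower (xv j)) = 0"
  unfolding pairing_def
proof (intro sum.neutral ballI)
  fix k assume "k \<in> {..d}"
  show "yv i k * lower (xv j) k = 0"
    using assms by (cases "i \<le> k") (simp_all add: yv_def lower_xv_zero)
qed

lemma pairing_lower_subdiagonal:
  assumes "j + 1 \<le> d"
  shows "pairing (j + 1) (lower (xv j)) = l (j + 1)"
proof -
  have "pairing (j + 1) (lower (xv j)) = (\<Sum>k\<in>{j + 1}. yv (j + 1) k * lower (xv j) k)"
    unfolding pairing_def
  proof (rule sum.mono_neutral_right)
    show "\<forall>k\<in>{..d} - {j + 1}. yv (j + 1) k * lower (xv j) k = 0"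
    proof
      fix k assume "k \<in> {..d} - {j + 1}"
      then consider "k < j + 1" | "k > j + 1" by fastforce
      then show "yv (j + 1) k * lower (xv j) k = 0"
        by cases (simp_all add: yv_def lower_xv_zero)
    qed
  qed (use assms in auto)
  then show ?thesis using lower_xv_subdiagonal[of j] by (simp add: yv_def)
qed

text \<open>An Askey-Wilson relation, checked diagonal by diagonal. The subdiagonal vanishes by the
  quadratic invariant \<open>r'\<close>; the second superdiagonal gives \<open>g\<close> by the
  recurrence of \<open>R\<close>; the superdiagonal and the main diagonal give \<open>w\<close> and
  \<open>h\<close>, as values of the constant sequences \<open>W\<close> and
  \<open>H\<close>.\<close>

lemma wilson_relation:
  "\<exists>g' r' g w h.
    (\<forall>k. t (k + 2) = \<beta> * t (k + 1) - t k + g') \<and>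
    (\<forall>k. t k * t k - \<beta> * (t k * t (k + 1)) + t (k + 1) * t (k + 1) - g' * (t k + t (k + 1)) = r') \<and>
    (\<forall>x. \<forall>k\<le>d.
      upper (upper (lower x)) k - \<beta> * upper (lower (upper x)) k + lower (upper (upper x)) k
      - g' * (upper (lower x) k + lower (upper x) k) - r' * lower x k
      = g * upper (upper x) k + w * upper x k + h * x k)"
proof -
  obtain g' where g': "\<And>k. t (k + 2) = \<beta> * t (k + 1) - t k + g'"
    using recurrent_second_order[OF t] by blast
  obtain r' where r': "\<And>k. t k * t k - \<beta> * (t k * t (k + 1)) + t (k + 1) * t (k + 1) - g' * (t k + t (k + 1)) = r'"
    using quadratic_invariant[of t, OF g'] by blast
  obtain g where g: "\<And>k. R (k + 2) = \<beta> * R (k + 1) - R k + g"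
    using recurrent_second_order[OF R] by blast
  define \<phi> where "\<phi> k = v k + (t k - t 0) * (R k - R (d + 1))" for k
  \<comment> \<open>The coefficient of \<open>x (k + 1)\<close> on the left without its factor
    \<open>u (k + 1)\<close>, minus the contribution of \<open>g * upper (upper x)\<close>.\<close>
  define W where "W k = (t k + t (k + 1)) * (R (k + 1) + R (k + 2)) + \<phi> k + \<phi> (k + 2)
    - \<beta> * (t k * R (k + 1) + t (k + 1) * R (k + 2) + \<phi> (k + 1)) - g' * (R (k + 1) + R (k + 2))
    - g * (t k + t (k + 1))" for k
  have idx: "Suc k + 1 = k + 2" "Suc k + 2 = k + 3" "Suc k = k + 1" "k + 1 + 1 = k + 2" "k + 1 + 2 = k + 3" for k
    by simp_all
  have W_step: "W (Suc k) = W k" for k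
    unfolding W_def idx
    by (rule subdiagonal_identity[where ?v1.0 = "v (k + 1)", OF _ _ _ _ recurrentD[OF v, of k]])
      (use g'[of k] g'[of "k + 1"] g[of k] g[of "k + 1"] in \<open>simp_all only: \<phi>_def idx\<close>)
  define w where "w = W 0"
  have W: "W k = w" for k by (induction k) (simp_all only: W_step w_def)
  \<comment> \<open>The coefficient of \<open>x k\<close> on the left, minus the contributions of
    \<open>g\<close> and \<open>w\<close>; \<open>t (k - 1)\<close> has been eliminated by the
    recurrence.\<close>
  define H where "H k = R (k + 1) * (2 * (t k * t k) - \<beta> * (t k * t k) - 2 * (g' * t k) - r')
    + \<phi> (k + 1) * (t k + t (k + 1) - \<beta> * t k - g') + \<phi> k * (t k - t (k + 1))
    - g * (t k * t k) - w * t k" for k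
  have H_step: "H (Suc k) = H k" for k
  proof -
    have "H (Suc k) - H k = (t (k + 1) - t k) * (W k - w)"
      unfolding H_def W_def idx r'[of k, symmetric] g'[of k] by (simp add: algebra_simps)
    then show ?thesis using W[of k] by simp
  qed
  define h where "h = H 0"
  have H: "H k = h" for k by (induction k) (simp_all only: H_step h_def)
  have main: "upper (upper (lower x)) k - \<beta> * upper (lower (upper x)) k + lower (upper (upper x)) k
      - g' * (upper (lower x) k + lower (upper x) k) - r' * lower x k
      = g * upper (upper x) k + w * upper x k + h * x k" if k: "k \<le> d" for x k
  proof -
    define sub where "sub = (case k of 0 \<Rightarrow> 0 | Suc m \<Rightarrow>
      l k * x m * (t k * t k - \<beta> * (t m * t k) + t m * t m - g' * (t m + t k) - r'))"
    have sub: "sub = 0"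
      unfolding sub_def using r'[of "k - 1"] by (cases k) (simp_all add: algebra_simps)
    \<comment> \<open>This is \<open>t (k - 1)\<close> for \<open>k > 0\<close>; at
      \<open>k = 0\<close> it only occurs multiplied by \<open>l 0 = 0\<close>.\<close>
    define tm where "tm = \<beta> * t k - t (k + 1) + g'"
    have expand: "upper (upper (lower x)) k - \<beta> * upper (lower (upper x)) k + lower (upper (upper x)) k
      - g' * (upper (lower x) k + lower (upper x) k) - r' * lower x k
      = sub
      + (R (k + 1) * (2 * (t k * t k) - \<beta> * (t k * t k) - 2 * (g' * t k) - r')
         + u (k + 1) * l (k + 1) * (t k + t (k + 1) - \<beta> * t k - g')
         + u k * l k * (t k + tm - \<beta> * t k - g')) * x k
      + u (k + 1) * ((t k + t (k + 1)) * (R (k + 1) + R (k + 2)) + u k * l k + u (k + 2) * l (k + 2)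
         - \<beta> * (t k * R (k + 1) + t (k + 1) * R (k + 2) + u (k + 1) * l (k + 1)) - g' * (R (k + 1) + R (k + 2))) * x (k + 1)
      + u (k + 1) * u (k + 2) * (R (k + 1) - \<beta> * R (k + 2) + R (k + 3)) * x (k + 2)"
    proof (cases k)
      case 0
      then show ?thesis
        using l_end unfolding sub_def upper_def lower_def by (simp add: algebra_simps numeral_eq_Suc)
    next
      case (Suc m)
      have tm: "tm = t m" using g'[of m] Suc unfolding tm_def by simp
      show ?thesis
        unfolding tm unfolding Suc sub_def upper_def lower_def by (simp add: algebra_simps numeral_eq_Suc)
    qed
    have low: "t k + tm - \<beta> * t k - g' = t k - t (k + 1)" unfolding tm_def by simp
    have top: "R (k + 1) - \<beta> * R (k + 2) + R (k + 3) = g"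
      using g[of "k + 1"] by (simp add: numeral_eq_Suc)
    have ul0: "u k * l k = \<phi> k" using ul[of k] k unfolding \<phi>_def by simp
    have ul1: "u (k + 1) * l (k + 1) = \<phi> (k + 1)" using ul[of "k + 1"] k unfolding \<phi>_def by simp
    \<comment> \<open>At \<open>k = d\<close> the product \<open>u (k + 2) * l (k + 2)\<close> is
      outside the range of \<open>ul\<close>, but the prefactor \<open>u (d + 1)\<close> is
      0.\<close>
    have super: "u (k + 1) * ((t k + t (k + 1)) * (R (k + 1) + R (k + 2)) + \<phi> k + u (k + 2) * l (k + 2)
         - \<beta> * (t k * R (k + 1) + t (k + 1) * R (k + 2) + \<phi> (k + 1)) - g' * (R (k + 1) + R (k + 2)))
      = u (k + 1) * (w + g * (t k + t (k + 1)))"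
    proof (cases "k = d")
      case False
      then have "u (k + 2) * l (k + 2) = \<phi> (k + 2)" using ul[of "k + 2"] k unfolding \<phi>_def by simp
      then show ?thesis using W[of k] unfolding W_def by (simp add: algebra_simps)
    qed (use u_end in simp)
    have diag: "R (k + 1) * (2 * (t k * t k) - \<beta> * (t k * t k) - 2 * (g' * t k) - r')
       + \<phi> (k + 1) * (t k + t (k + 1) - \<beta> * t k - g') + \<phi> k * (t k - t (k + 1))
       = h + g * (t k * t k) + w * t k"
      using H[of k] unfolding H_def diff_eq_eq by (simp only: ac_simps)
    show ?thesis
      unfolding expand low top ul0 ul1 super diag sub unfolding upper_def by (simp add: algebra_simps numeral_eq_Suc)
  qed
  show ?thesis using g' r' main by blast
qed

lemma pairing_lower_interior:
  assumes i: "i \<le> d" and j: "j \<le> d" and ij: "i + 1 < j" "j < i + d"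
  shows "pairing i (lower (xv j)) = 0"
proof -
  obtain g' r' g w h where g': "\<And>k. t (k + 2) = \<beta> * t (k + 1) - t k + g'"
    and r': "\<And>k. t k * t k - \<beta> * (t k * t (k + 1)) + t (k + 1) * t (k + 1) - g' * (t k + t (k + 1)) = r'"
    and rel: "\<And>x k. k \<le> d \<Longrightarrow>
      upper (upper (lower x)) k - \<beta> * upper (lower (upper x)) k + lower (upper (upper x)) k
      - g' * (upper (lower x) k + lower (upper x) k) - r' * lower x k
      = g * upper (upper x) k + w * upper x k + h * x k"
    using wilson_relation by blast
  define m where "m = pairing i (lower (xv j))"
  let ?P = "\<lambda>a b. a * a - \<beta> * (a * b) + b * b - g' * (a + b) - r'"
  have "pairing i (\<lambda>k. upper (upper (lower (xv j))) k - \<beta> * upper (lower (upper (xv j))) k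
      + lower (upper (upper (xv j))) k
      - g' * (upper (lower (xv j)) k + lower (upper (xv j)) k) - r' * lower (xv j) k)
    = pairing i (\<lambda>k. g * upper (upper (xv j)) k + w * upper (xv j) k + h * xv j k)"
    unfolding pairing_def by (intro sum.cong refl arg_cong2[where f = "(*)"] rel) simp
  moreover have "pairing i (\<lambda>k. upper (upper (lower (xv j))) k - \<beta> * upper (lower (upper (xv j))) k
      + lower (upper (upper (xv j))) k
      - g' * (upper (lower (xv j)) k + lower (upper (xv j)) k) - r' * lower (xv j) k)
    = pairing i (upper (upper (lower (xv j)))) - \<beta> * pairing i (upper (lower (upper (xv j))))
      + pairing i (lower (upper (upper (xv j))))
      - g' * (pairing i (upper (lower (xv j))) + pairing i (lower (upper (xv j)))) - r' * m"
    unfolding m_def pairing_def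
    by (simp add: sum_distrib_left sum.distrib sum_subtractf algebra_simps)
  \<comment> \<open>Each \<open>upper\<close> applied after \<open>lower\<close> contributes
    \<open>t i\<close>, each one applied before it \<open>t j\<close>.\<close>
  moreover have "\<dots> = ?P (t i) (t j) * m"
    by (simp add: upper_xv[OF j] upper_scale lower_scale pairing_scale pairing_upper[OF i] m_def[symmetric] algebra_simps)
  moreover have "pairing i (\<lambda>k. g * upper (upper (xv j)) k + w * upper (xv j) k + h * xv j k) = 0"
  proof -
    have "pairing i (\<lambda>k. g * upper (upper (xv j)) k + w * upper (xv j) k + h * xv j k)
       = pairing i (\<lambda>k. (g * (t j * t j) + w * t j + h) * xv j k)"
      by (simp add: upper_xv[OF j] upper_scale algebra_simps)
    then show ?thesis using pairing_xv[OF i j] ij unfolding pairing_scale by simp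
  qed
  ultimately have Pm: "?P (t i) (t j) * m = 0" by simp
  \<comment> \<open>By the invariant, both neighbours of \<open>t (k + 1)\<close> are roots of this
    monic quadratic in \<open>y\<close>.\<close>
  have factor: "?P (t (k + 1)) y = (y - t k) * (y - t (k + 2))" for k y
    unfolding g'[of k] r'[of k, symmetric] by (simp add: algebra_simps)
  have "?P (t i) (t j) \<noteq> 0"
  \<comment> \<open>Index 0 has no left neighbour; there the symmetry of \<open>?P\<close> allows
    factoring at \<open>j\<close>, which satisfies \<open>1 < j < d\<close>.\<close>
  proof (cases "i = 0")
    case True
    define k where "k = j - 1"
    have k: "j = k + 1" using ij unfolding k_def by simp
    have "?P (t i) (t j) = ?P (t j) (t i)" by (simp add: algebra_simps)
    also have "\<dots> = (t i - t k) * (t i - t (k + 2))" unfolding k by (rule factor)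
    finally show ?thesis using t_neq[of i k] t_neq[of i "k + 2"] True k ij by simp
  next
    case False
    define k where "k = i - 1"
    have k: "i = k + 1" using False unfolding k_def by simp
    have "?P (t i) (t j) = (t j - t k) * (t j - t (k + 2))" unfolding k by (rule factor)
    then show ?thesis using t_neq[of j k] t_neq[of j "k + 2"] k ij i j by simp
  qed
  then show ?thesis using Pm unfolding m_def by simp
qed

text \<open>After the product \<open>u * l\<close> is replaced and \<open>v\<close> decomposed, the
  off-diagonal part telescopes to \<open>c d * a d\<close>. The terms in \<open>R\<close> cancel
  except for \<open>R (d + 1)\<close> times the sum of all \<open>a k\<close>, which is 0 by
  biorthogonality.\<close>

lemma pairing_lower_corner: "pairing 0 (lower (xv d)) \<noteq> 0"
proof -
  have td: "t d \<noteq> t 0" "t d \<noteq> t 1" using t_neq[of d 0] t_neq[of d 1] d by auto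
  have d1: "1 \<le> d" using d by simp
  obtain c where c0: "c 0 = 0" and cd: "c d = (v 1 - v d) / (t 1 - t d)"
    and c: "\<And>k. v (k + 1) = c (k + 1) * (t d - t k) - c k * (t 0 - t (k + 1))"
    using recurrent_wedge_decomposition[OF t v v_ends v_neq d1 td] by blast
  define a where "a k = yv 0 k * xv d k" for k
  have summand: "yv 0 (Suc k) * (l (Suc k) * xv d k)
      = (c (Suc k) * a (Suc k) - c k * a k) - a k * (R (k + 1) - R (d + 1))" if k: "k < d" for k
  proof -
    \<comment> \<open>The common factor: \<open>a k\<close> and \<open>a (k + 1)\<close> are its
      multiples by exactly the two differences occurring in the decomposition of
      \<open>v (k + 1)\<close>.\<close>
    define e where "e = yv 0 (k + 1) * xv d k / u (k + 1)"
    have uk: "u (k + 1) \<noteq> 0" using u_nz[of "k + 1"] k by simp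
    have e1: "a k = e * (t 0 - t (k + 1))"
      using yv_step[OF k, of 0] uk unfolding e_def a_def by (simp add: field_simps)
    have e2: "a (k + 1) = e * (t d - t k)"
    proof -
      have "e * (t d - t k) = yv 0 (k + 1) * ((t d - t k) * xv d k) / u (k + 1)"
        unfolding e_def by simp
      also have "\<dots> = a (k + 1)"
        unfolding xv_step[OF order_refl k] a_def using uk by simp
      finally show ?thesis by simp
    qed
    have "yv 0 (Suc k) * (l (Suc k) * xv d k) = e * (u (k + 1) * l (k + 1))"
      using uk unfolding e_def by simp
    also have "\<dots> = e * (v (k + 1) + (t (k + 1) - t 0) * (R (k + 1) - R (d + 1)))"
      using ul[of "k + 1"] k by simp
    also have "\<dots> = (c (k + 1) * (e * (t d - t k)) - c k * (e * (t 0 - t (k + 1))))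
        - e * (t 0 - t (k + 1)) * (R (k + 1) - R (d + 1))"
      unfolding c by (simp add: algebra_simps)
    finally show ?thesis unfolding e1[symmetric] e2[symmetric] by simp
  qed
  have "pairing 0 (lower (xv d)) = (\<Sum>k\<le>d. R (k + 1) * a k) + (\<Sum>k\<le>d. yv 0 k * (l k * xv d (k - 1)))"
    unfolding pairing_def lower_def a_def by (simp add: distrib_left sum.distrib ac_simps)
  also have "(\<Sum>k\<le>d. yv 0 k * (l k * xv d (k - 1))) = (\<Sum>k<d. yv 0 (Suc k) * (l (Suc k) * xv d k))"
    unfolding sum.atMost_shift using l_end by simp
  also have "\<dots> = (\<Sum>k<d. (c (Suc k) * a (Suc k) - c k * a k) - a k * (R (k + 1) - R (d + 1)))"
    by (rule sum.cong) (simp_all only: summand lessThan_iff)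
  also have "\<dots> = c d * a d - (\<Sum>k<d. a k * (R (k + 1) - R (d + 1)))"
    unfolding sum_subtractf[of "\<lambda>k. c (Suc k) * a (Suc k) - c k * a k"]
      sum_lessThan_telescope[of "\<lambda>k. c k * a k"] using c0 by simp
  \<comment> \<open>The added summand at \<open>k = d\<close> contains
    \<open>R (d + 1) - R (d + 1)\<close>.\<close>
  also have "(\<Sum>k<d. a k * (R (k + 1) - R (d + 1))) = (\<Sum>k\<le>d. a k * (R (k + 1) - R (d + 1)))"
    by (simp add: lessThan_Suc_atMost[symmetric])
  also have "(\<Sum>k\<le>d. R (k + 1) * a k) + (c d * a d - \<dots>) = c d * a d + R (d + 1) * (\<Sum>k\<le>d. a k)"
    by (simp add: right_diff_distrib sum_subtractf sum_distrib_left ac_simps)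
  also have "(\<Sum>k\<le>d. a k) = 0"
    using pairing_xv[of 0 d] d unfolding pairing_def a_def by simp
  finally have "pairing 0 (lower (xv d)) = c d * a d" by simp
  moreover have "a d \<noteq> 0"
    using u_nz t_neq[of 0] unfolding a_def yv_def xv_def by auto
  moreover have "c d \<noteq> 0" unfolding cd using v_neq td by simp
  ultimately show ?thesis by simp
qed

end

section \<open>Circular entries\<close>

definition circular_entries :: "nat \<Rightarrow> 'a::zero mat \<Rightarrow> bool" where
  "circular_entries d M \<longleftrightarrow>
     (\<forall>i \<le> d. \<forall>j \<le> d.
        (j + 1 < i \<or> (i + 1 < j \<and> j < i + d) \<longrightarrow> M $$ (i, j) = 0) \<and>
        (i = j + 1 \<or> j = i + d \<longrightarrow> M $$ (i, j) \<noteq> 0))"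

context eigenbasis
begin

lemma idempotent_ordering_primitive_idempotents:
  assumes n: "n = d + 1" and E: "\<forall>i\<le>d. E i = primitive_idempotent n B (f i)"
  shows "idempotent_ordering d B E"
proof -
  have "{0..d} = {..<n}" using n by auto
  moreover have "E i = proj i" if "i \<in> {..<n}" for i
    using E primitive_idempotent_eq that n by simp
  ultimately show ?thesis
    unfolding idempotent_ordering_def n[symmetric] using proj_bij bij_betw_cong by metis
qed

lemma circular_pattern_primitive_idempotents:
  assumes n: "n = d + 1" and E: "\<forall>i\<le>d. E i = primitive_idempotent n B (f i)"
    and C: "C \<in> carrier_mat n n" and M: "circular_entries d (Y * C * X)"
  shows "circular_pattern d E C"
proof -
  have E': "E i = proj i" if "i \<le> d" for i
    using E primitive_idempotent_eq that n by simp
  have "E i * C * E j = 0\<^sub>m (d + 1) (d + 1) \<longleftrightarrow> (Y * C * X) $$ (i, j) = 0" if "i \<le> d" "j \<le> d" for i j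
    using proj_mult_proj[OF C, of i j] that n E' by simp
  then show ?thesis using M unfolding circular_pattern_def circular_entries_def by simp
qed

text \<open>Conjugating both maps by an involution moves the eigenbasis along and leaves the
  representing matrix of \<open>C\<close> unchanged.\<close>

lemma conjugate:
  assumes J: "J \<in> carrier_mat n n" and JJ: "J * J = 1\<^sub>m n"
  shows "eigenbasis n (J * B * J) (J * X) (Y * J) f"
    and "C \<in> carrier_mat n n \<Longrightarrow> (Y * J) * (J * C * J) * (J * X) = Y * C * X"
proof -
  have cancel: "J * (J * M) = M" if "M \<in> carrier_mat n n" for M
    using assoc[OF J J that] JJ that by simp
  show "eigenbasis n (J * B * J) (J * X) (Y * J) f"
  proof
    show "Y * J * (J * X) = 1\<^sub>m n" by (simp add: assoc closed cancel J X Y YX)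
    show "J * B * J * (J * X) = J * X * mat_diag n f"
      by (simp add: assoc closed cancel J X B BX)
  qed (simp_all add: closed J B X Y inj)
  show "(Y * J) * (J * C * J) * (J * X) = Y * C * X" if "C \<in> carrier_mat n n"
    using that by (simp add: assoc closed cancel J X Y)
qed

end

section \<open>Reversing the standard basis\<close>

definition reversal :: "nat \<Rightarrow> 'a::field mat" where
  "reversal d = mat (d + 1) (d + 1) (\<lambda>(i, j). if i + j = d then 1 else 0)"

lemma reversal_carrier: "reversal d \<in> carrier_mat (d + 1) (d + 1)"
  unfolding reversal_def by simp

lemma index_mult_mat_sum:
  assumes "A \<in> carrier_mat n m" "B \<in> carrier_mat m p" "i < n" "j < p"
  shows "(A * B) $$ (i, j) = (\<Sum>k<m. A $$ (i, k) * B $$ (k, j))"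
  using assms by (simp add: scalar_prod_def atLeast0LessThan)

lemma reversal_mult_left:
  assumes "M \<in> carrier_mat (d + 1) (d + 1)"
  shows "reversal d * M = mat (d + 1) (d + 1) (\<lambda>(i, j). M $$ (d - i, j))"
proof (rule eq_matI; simp)
  fix i j assume ij: "i < Suc d" "j < Suc d"
  have "(reversal d * M) $$ (i, j) = (\<Sum>k<d + 1. reversal d $$ (i, k) * M $$ (k, j))"
    by (rule index_mult_mat_sum[OF reversal_carrier assms]) (use ij in simp_all)
  also have "\<dots> = (\<Sum>k<d + 1. if k = d - i then M $$ (d - i, j) else 0)"
    by (rule sum.cong) (use ij in \<open>auto simp: reversal_def\<close>)
  finally show "(reversal d * M) $$ (i, j) = M $$ (d - i, j)" using ij by (simp del: sum.lessThan_Suc)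
qed (use assms in \<open>simp_all add: reversal_def\<close>)

lemma reversal_mult_right:
  assumes "M \<in> carrier_mat (d + 1) (d + 1)"
  shows "M * reversal d = mat (d + 1) (d + 1) (\<lambda>(i, j). M $$ (i, d - j))"
proof (rule eq_matI; simp)
  fix i j assume ij: "i < Suc d" "j < Suc d"
  have "(M * reversal d) $$ (i, j) = (\<Sum>k<d + 1. M $$ (i, k) * reversal d $$ (k, j))"
    by (rule index_mult_mat_sum[OF assms reversal_carrier]) (use ij in simp_all)
  also have "\<dots> = (\<Sum>k<d + 1. if k = d - j then M $$ (i, d - j) else 0)"
    by (rule sum.cong) (use ij in \<open>auto simp: reversal_def\<close>)
  finally show "(M * reversal d) $$ (i, j) = M $$ (i, d - j)" using ij by (simp del: sum.lessThan_Suc)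
qed (use assms in \<open>simp_all add: reversal_def\<close>)

lemma reversal_reversal: "reversal d * reversal d = 1\<^sub>m (d + 1)"
  unfolding reversal_mult_left[OF reversal_carrier]
  by (rule eq_matI) (auto simp: reversal_def)

lemma reversal_conjugate:
  assumes "M \<in> carrier_mat (d + 1) (d + 1)"
  shows "reversal d * M * reversal d = mat (d + 1) (d + 1) (\<lambda>(i, j). M $$ (d - i, d - j))"
  unfolding reversal_mult_left[OF assms]
  by (subst reversal_mult_right) (auto intro!: eq_matI)

definition upper_bidiagonal :: "nat \<Rightarrow> (nat \<Rightarrow> 'a::field) \<Rightarrow> (nat \<Rightarrow> 'a) \<Rightarrow> 'a mat" where
  "upper_bidiagonal d t u =
     mat (d + 1) (d + 1) (\<lambda>(i, j). if i = j then t i else if j = i + 1 then u j else 0)"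

definition lower_bidiagonal :: "nat \<Rightarrow> (nat \<Rightarrow> 'a::field) \<Rightarrow> (nat \<Rightarrow> 'a) \<Rightarrow> 'a mat" where
  "lower_bidiagonal d s l =
     mat (d + 1) (d + 1) (\<lambda>(i, j). if i = j then s i else if i = j + 1 then l i else 0)"

context bidiagonal_pair
begin

definition X where "X = mat (d + 1) (d + 1) (\<lambda>(k, j). xv j k)"
definition Y where "Y = mat (d + 1) (d + 1) (\<lambda>(i, k). yv i k)"

lemma upper_bidiagonal_mult:
  "upper_bidiagonal d t u * mat (d + 1) (d + 1) (\<lambda>(k, j). z j k) = mat (d + 1) (d + 1) (\<lambda>(k, j). upper (z j) k)"
    (is "?B * ?Z = _")
proof (rule eq_matI)
  fix k j assume "k < dim_row (mat (d + 1) (d + 1) (\<lambda>(k, j). upper (z j) k))"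
    "j < dim_col (mat (d + 1) (d + 1) (\<lambda>(k, j). upper (z j) k))"
  then have kj: "k < d + 1" "j < d + 1" by simp_all
  have "(?B * ?Z) $$ (k, j) = (\<Sum>i<d + 1. ?B $$ (k, i) * ?Z $$ (i, j))"
    by (rule index_mult_mat_sum[of _ "d + 1" _ _ "d + 1"]) (use kj in \<open>simp_all add: upper_bidiagonal_def\<close>)
  also have "\<dots> = (\<Sum>i<d + 1. (if i = k then t k * z j k else 0) + (if i = k + 1 then u (k + 1) * z j (k + 1) else 0))"
    by (rule sum.cong) (use kj in \<open>auto simp: upper_bidiagonal_def\<close>)
  also have "\<dots> = upper (z j) k"
    using kj u_end by (cases "k = d") (simp_all add: sum.distrib upper_def del: sum.lessThan_Suc)
  finally show "(?B * ?Z) $$ (k, j) = mat (d + 1) (d + 1) (\<lambda>(k, j). upper (z j) k) $$ (k, j)"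
    using kj by simp
qed (simp_all add: upper_bidiagonal_def)

lemma lower_bidiagonal_mult:
  "lower_bidiagonal d (\<lambda>k. R (k + 1)) l * mat (d + 1) (d + 1) (\<lambda>(k, j). z j k)
    = mat (d + 1) (d + 1) (\<lambda>(k, j). lower (z j) k)" (is "?C * ?Z = _")
proof (rule eq_matI)
  fix k j assume "k < dim_row (mat (d + 1) (d + 1) (\<lambda>(k, j). lower (z j) k))"
    "j < dim_col (mat (d + 1) (d + 1) (\<lambda>(k, j). lower (z j) k))"
  then have kj: "k < d + 1" "j < d + 1" by simp_all
  have "(?C * ?Z) $$ (k, j) = (\<Sum>i<d + 1. ?C $$ (k, i) * ?Z $$ (i, j))"
    by (rule index_mult_mat_sum[of _ "d + 1" _ _ "d + 1"]) (use kj in \<open>simp_all add: lower_bidiagonal_def\<close>)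
  \<comment> \<open>At \<open>k = 0\<close> the truncated \<open>k - 1\<close> equals 0, and the
    second summand vanishes because \<open>l 0 = 0\<close>.\<close>
  also have "\<dots> = (\<Sum>i<d + 1. (if i = k then R (k + 1) * z j k else 0) + (if i = k - 1 then l k * z j (k - 1) else 0))"
  proof (rule sum.cong)
    show "?C $$ (k, i) * ?Z $$ (i, j) =
        (if i = k then R (k + 1) * z j k else 0) + (if i = k - 1 then l k * z j (k - 1) else 0)"
      if "i \<in> {..<d + 1}" for i
      using that kj l_end by (cases "k = 0") (auto simp: lower_bidiagonal_def)
  qed simp
  also have "\<dots> = lower (z j) k"
    using kj by (simp add: sum.distrib lower_def del: sum.lessThan_Suc)
  finally show "(?C * ?Z) $$ (k, j) = mat (d + 1) (d + 1) (\<lambda>(k, j). lower (z j) k) $$ (k, j)"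
    using kj by simp
qed (simp_all add: lower_bidiagonal_def)

lemma Y_mult:
  "Y * mat (d + 1) (d + 1) (\<lambda>(k, j). z j k) = mat (d + 1) (d + 1) (\<lambda>(i, j). pairing i (z j))"
  by (rule eq_matI) (auto simp: Y_def scalar_prod_def pairing_def atLeast0LessThan lessThan_Suc_atMost)

lemma eigenbasis_upper_bidiagonal: "eigenbasis (d + 1) (upper_bidiagonal d t u) X Y t"
proof
  show "Y * X = 1\<^sub>m (d + 1)"
    unfolding X_def Y_mult by (rule eq_matI) (auto simp: pairing_xv)
  show "upper_bidiagonal d t u * X = X * mat_diag (d + 1) t"
    unfolding X_def upper_bidiagonal_mult
    by (subst mat_diag_mult_right[of _ "d + 1"]) (auto intro!: eq_matI simp: upper_xv)
  show "inj_on t {..<d + 1}" using inj by (simp add: lessThan_Suc_atMost)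
qed (simp_all add: X_def Y_def upper_bidiagonal_def)

lemma circular_entries_lower_bidiagonal:
  "circular_entries d (Y * lower_bidiagonal d (\<lambda>k. R (k + 1)) l * X)"
proof -
  have "Y * lower_bidiagonal d (\<lambda>k. R (k + 1)) l * X = Y * (lower_bidiagonal d (\<lambda>k. R (k + 1)) l * X)"
    by (rule assoc_mult_mat[of _ "d + 1" "d + 1" _ "d + 1" _ "d + 1"]) (simp_all add: X_def Y_def lower_bidiagonal_def)
  also have "\<dots> = mat (d + 1) (d + 1) (\<lambda>(i, j). pairing i (lower (xv j)))"
    unfolding X_def lower_bidiagonal_mult Y_mult ..
  finally have M: "Y * lower_bidiagonal d (\<lambda>k. R (k + 1)) l * X = \<dots>" .
  show ?thesis
    unfolding circular_entries_def M
  proof (intro allI impI conjI)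
    fix i j assume ij: "i \<le> d" "j \<le> d"
    {
      assume "j + 1 < i \<or> i + 1 < j \<and> j < i + d"
      then have "pairing i (lower (xv j)) = 0"
        using pairing_lower_below pairing_lower_interior[OF ij] by blast
      then show "mat (d + 1) (d + 1) (\<lambda>(i, j). pairing i (lower (xv j))) $$ (i, j) = 0"
        using ij by simp
    next
      assume "i = j + 1 \<or> j = i + d"
      then have "pairing i (lower (xv j)) \<noteq> 0"
      proof
        assume "i = j + 1"
        then show ?thesis using pairing_lower_subdiagonal[of j] l_nz[of "j + 1"] ij by simp
      next
        assume "j = i + d"
        then show ?thesis using pairing_lower_corner ij by simp
      qed
      then show "mat (d + 1) (d + 1) (\<lambda>(i, j). pairing i (lower (xv j))) $$ (i, j) \<noteq> 0"
        using ij by simp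
    }
  qed
qed

end

section \<open>From finite data to the circular Hessenberg system\<close>

lemma recurrent_imp_beta_recurrent:
  assumes "recurrent \<beta> \<sigma>"
  shows "beta_recurrent \<beta> n \<sigma>"
  unfolding beta_recurrent_def
proof (intro allI impI)
  fix i assume "2 \<le> i \<and> i \<le> n - 1"
  then obtain k where "i = k + 2" by (metis add.commute le_Suc_ex)
  then show "\<sigma> (i - 2) - (\<beta> + 1) * \<sigma> (i - 1) + (\<beta> + 1) * \<sigma> i - \<sigma> (i + 1) = 0"
    using recurrentD[OF assms, of k] by (simp add: numeral_3_eq_3)
qed

text \<open>Provides the infinite sequences and the end values that \<open>bidiagonal_pair\<close>
  demands. They agree with the given data at every index occurring in the two matrices.\<close>

lemma bidiagonal_eigenbasis:
  fixes t s v u l :: "nat \<Rightarrow> 'a::field"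
  assumes d: "3 \<le> d" and t_inj: "inj_on t {..d}"
    and nz: "\<And>k. k \<in> {1..d} \<Longrightarrow> u k \<noteq> 0 \<and> l k \<noteq> 0"
    and v0: "v 0 = 0" "v (d + 1) = 0" and v1: "v 1 \<noteq> v d"
    and rec: "beta_recurrent \<beta> d t" "beta_recurrent \<beta> d s" "beta_recurrent \<beta> (d + 1) v"
    and ul: "\<And>k. k \<in> {1..d} \<Longrightarrow> u k * l k = v k + (t k - t 0) * (s (d + 1 - k) - s 0)"
  shows "\<exists>X Y. eigenbasis (d + 1) (upper_bidiagonal d t u) X Y t \<and>
    circular_entries d (Y * lower_bidiagonal d (\<lambda>k. s (d - k)) l * X)"
proof -
  obtain te where te: "recurrent \<beta> te" "\<forall>k\<le>d. te k = t k"
    using beta_recurrent_extend[OF rec(1)] by blast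
  obtain se where se: "recurrent \<beta> se" "\<forall>k\<le>d. se k = s k"
    using beta_recurrent_extend[OF rec(2)] by blast
  obtain ve where ve: "recurrent \<beta> ve" "\<forall>k\<le>d + 1. ve k = v k"
    using beta_recurrent_extend[OF rec(3)] by blast
  \<comment> \<open>Reversal is about \<open>d + 1\<close>, so \<open>R 0 = se (d + 1)\<close> lies
    beyond the given range; hence \<open>s\<close> is extended before it is reversed.\<close>
  obtain R where R_eq: "recurrent \<beta> R" "\<forall>k\<le>d + 1. R k = se (d + 1 - k)"
    using beta_recurrent_extend[OF beta_recurrent_rev[OF recurrent_imp_beta_recurrent[OF se(1)]]] by blast
  \<comment> \<open>Zero outside \<open>{1..d}\<close>, as \<open>u (d + 1) = 0\<close> and
    \<open>l 0 = 0\<close> are required.\<close>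
  define ue le where "ue k = (if k \<in> {1..d} then u k else 0)"
    and "le k = (if k \<in> {1..d} then l k else 0)" for k
  interpret bidiagonal_pair d \<beta> te R ve ue le
  proof
    show "inj_on te {..d}" using t_inj te(2) by (simp add: inj_on_def)
    show "ue k * le k = ve k + (te k - te 0) * (R k - R (d + 1))" if "k \<le> d + 1" for k
    proof -
      have "k = 0 \<or> k = d + 1 \<or> k \<in> {1..d}" using that by auto
      then consider "k = 0" | "k = d + 1" | "k \<in> {1..d}" by blast
      then show ?thesis
      proof cases
        case 3
        then have "d + 1 - k \<le> d" by auto
        then show ?thesis using 3 ul[OF 3] te(2) ve(2) R_eq(2) se(2) by (simp add: ue_def le_def)
      qed (use v0 ve(2) in \<open>simp_all add: ue_def\<close>)
    qed
  qed (use d te ve R_eq v0 v1 nz in \<open>auto simp: ue_def le_def\<close>)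
  have B: "upper_bidiagonal d te ue = upper_bidiagonal d t u"
    unfolding upper_bidiagonal_def by (rule eq_matI) (use te(2) in \<open>auto simp: ue_def\<close>)
  have C: "lower_bidiagonal d (\<lambda>k. R (k + 1)) le = lower_bidiagonal d (\<lambda>k. s (d - k)) l"
    unfolding lower_bidiagonal_def by (rule eq_matI) (use R_eq(2) se(2) in \<open>auto simp: le_def\<close>)
  have D: "mat_diag (d + 1) te = mat_diag (d + 1) t"
    unfolding mat_diag_def by (rule eq_matI) (use te(2) in auto)
  have "inj_on t {..<d + 1}" using t_inj by (simp add: lessThan_Suc_atMost)
  then have "eigenbasis (d + 1) (upper_bidiagonal d t u) X Y t"
    using eigenbasis_upper_bidiagonal unfolding eigenbasis_def B D by blast
  then show ?thesis using circular_entries_lower_bidiagonal unfolding C by blast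
qed

theorem theorem2p17:
  fixes d :: nat
    and \<theta> \<theta>' \<phi> vartheta :: "nat \<Rightarrow> 'a::field"
    and A A' :: "'a mat"
    and E E' :: "nat \<Rightarrow> 'a mat"
  assumes "d \<ge> 3"
    and "\<forall>i\<le>d. \<forall>j\<le>d. i \<noteq> j \<longrightarrow> \<theta> i \<noteq> \<theta> j \<and> \<theta>' i \<noteq> \<theta>' j"
    and "\<forall>i\<in>{1..d}. \<phi> i \<noteq> 0"
    and "A = mat (d + 1) (d + 1)
               (\<lambda>(i, j). if i = j then \<theta> (d - i) else if i = j + 1 then 1 else 0)"
    and "A' = mat (d + 1) (d + 1)
               (\<lambda>(i, j). if i = j then \<theta>' i else if j = i + 1 then \<phi> j else 0)"
    and "\<forall>i\<le>d. E i = primitive_idempotent (d + 1) A (\<theta> i)"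
    and "\<forall>i\<le>d. E' i = primitive_idempotent (d + 1) A' (\<theta>' i)"
    and "vartheta 0 = 0"
    and "vartheta (d + 1) = 0"
    and "\<forall>i\<in>{1..d}. vartheta i = \<phi> i - (\<theta>' i - \<theta>' 0) * (\<theta> (d - i + 1) - \<theta> 0)"
    and "\<exists>\<beta>. beta_recurrent \<beta> d \<theta> \<and> beta_recurrent \<beta> d \<theta>' \<and> beta_recurrent \<beta> (d + 1) vartheta"
    and "vartheta 1 \<noteq> vartheta d"
  shows "CH_system d A E A' E'"
proof -
  obtain \<beta> where \<beta>: "beta_recurrent \<beta> d \<theta>" "beta_recurrent \<beta> d \<theta>'" "beta_recurrent \<beta> (d + 1) vartheta"
    using assms(11) by blast
  have inj: "inj_on \<theta> {..d}" "inj_on \<theta>' {..d}" using assms(2) unfolding inj_on_def by auto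
  have phi: "\<phi> k = vartheta k + (\<theta>' k - \<theta>' 0) * (\<theta> (d + 1 - k) - \<theta> 0)" if "k \<in> {1..d}" for k
    using assms(10) that by (auto simp: Suc_diff_le)
  have carrier: "A \<in> carrier_mat (d + 1) (d + 1)" "A' \<in> carrier_mat (d + 1) (d + 1)"
    using assms(4,5) by simp_all
  have A: "A = lower_bidiagonal d (\<lambda>k. \<theta> (d - k)) (\<lambda>_. 1)"
    unfolding assms(4) lower_bidiagonal_def by (rule refl)
  have A': "A' = upper_bidiagonal d \<theta>' \<phi>"
    unfolding assms(5) upper_bidiagonal_def by (rule refl)
  have "\<exists>X Y. eigenbasis (d + 1) (upper_bidiagonal d \<theta>' \<phi>) X Y \<theta>' \<and>
    circular_entries d (Y * lower_bidiagonal d (\<lambda>k. \<theta> (d - k)) (\<lambda>_. 1) * X)"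
    by (rule bidiagonal_eigenbasis[OF assms(1) inj(2) _ assms(8,9,12) \<beta>(2,1,3)])
      (use assms(3) phi in simp_all)
  then obtain X1 Y1 where 1: "eigenbasis (d + 1) A' X1 Y1 \<theta>'" "circular_entries d (Y1 * A * X1)"
    unfolding A A' by blast
  \<comment> \<open>The matrices of \<open>A\<close> and \<open>A'\<close> with respect to the
    reversed standard basis.\<close>
  define B C where "B = upper_bidiagonal d \<theta> (\<lambda>_. 1)"
    and "C = lower_bidiagonal d (\<lambda>k. \<theta>' (d - k)) (\<lambda>k. \<phi> (d + 1 - k))"
  have BC: "B \<in> carrier_mat (d + 1) (d + 1)" "C \<in> carrier_mat (d + 1) (d + 1)"
    unfolding B_def C_def upper_bidiagonal_def lower_bidiagonal_def by simp_all
  \<comment> \<open>The relation between \<open>\<phi>\<close> and \<open>vartheta\<close> is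
    preserved when \<open>\<theta>\<close> and \<open>\<theta>'\<close> are exchanged and
    \<open>k\<close> is replaced by \<open>d + 1 - k\<close>, so the same lemma applies.\<close>
  have "\<exists>X Y. eigenbasis (d + 1) B X Y \<theta> \<and> circular_entries d (Y * C * X)"
    unfolding B_def C_def
  proof (rule bidiagonal_eigenbasis[OF assms(1) inj(1) _ _ _ _ \<beta>(1,2) beta_recurrent_rev[OF \<beta>(3)]])
    show "vartheta (d + 1 - 1) \<noteq> vartheta (d + 1 - d)" using assms(12) by simp
    show "1 * \<phi> (d + 1 - k) =
        vartheta (d + 1 - k) + (\<theta> k - \<theta> 0) * (\<theta>' (d + 1 - k) - \<theta>' 0)" if "k \<in> {1..d}" for k
    proof -
      have "d + 1 - k \<in> {1..d}" "d + 1 - (d + 1 - k) = k" using that by auto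
      then show ?thesis using phi[of "d + 1 - k"] by (simp add: mult.commute)
    qed
    show "(1 :: 'a) \<noteq> 0 \<and> \<phi> (d + 1 - k) \<noteq> 0" if "k \<in> {1..d}" for k
    proof -
      have "d + 1 - k \<in> {1..d}" using that by auto
      then show ?thesis using assms(3) by simp
    qed
  qed (use assms(8,9) in simp_all)
  then obtain X2 Y2 where 2: "eigenbasis (d + 1) B X2 Y2 \<theta>" "circular_entries d (Y2 * C * X2)"
    by blast
  let ?J = "reversal d :: 'a mat"
  have flip: "d - i = d - j \<longleftrightarrow> i = j" "d - j = d - i + 1 \<longleftrightarrow> i = j + 1"
    "d - (d - i) = i" "d + 1 - (d - i) = i + 1" if "i < d + 1" "j < d + 1" for i j
    using that by auto
  have JB: "?J * B * ?J = A"
    unfolding reversal_conjugate[OF BC(1)] assms(4)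
    by (rule eq_matI) (simp_all add: B_def upper_bidiagonal_def flip[simplified])
  have JC: "?J * C * ?J = A'"
    unfolding reversal_conjugate[OF BC(2)] assms(5)
    by (rule eq_matI) (simp_all add: C_def lower_bidiagonal_def flip[simplified])
  note conj = eigenbasis.conjugate[OF 2(1) reversal_carrier reversal_reversal]
  have 3: "eigenbasis (d + 1) A (?J * X2) (Y2 * ?J) \<theta>" using conj(1) unfolding JB .
  have "circular_entries d (Y2 * ?J * A' * (?J * X2))" using conj(2)[OF BC(2)] 2(2) unfolding JC by simp
  then show ?thesis
    unfolding CH_system_def
    using eigenbasis.multiplicity_free[OF 1(1)] eigenbasis.multiplicity_free[OF 3]
      eigenbasis.idempotent_ordering_primitive_idempotents[OF 3 refl assms(6)]
      eigenbasis.idempotent_ordering_primitive_idempotents[OF 1(1) refl assms(7)]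
      eigenbasis.circular_pattern_primitive_idempotents[OF 3 refl assms(6) carrier(2)]
      eigenbasis.circular_pattern_primitive_idempotents[OF 1(1) refl assms(7) carrier(1) 1(2)]
    by blast
qed

end
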